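(* Let $\mathcal{M}\models\mathrm{KP}^{\mathcal{P}}$ be countable and non-standard. The following are equivalent: (a) $\mathcal{M}\models\Sigma_1^{\mathcal{P}}\text{-Separation}$. (b) For every $\alpha\in\mathrm{Ord}^{\mathcal{M}}$, there is a proper (i.e. non-surjective) rank-initial self-embedding of $\mathcal{M}$ which fixes $\mathcal{M}_\alpha$ pointwise.
   Context: Theories. The language is $\{\in\}$. Quantifiers of the forms $\exists x\in y$, $\forall x\in y$, $\exists x\subseteq y$, $\forall x\subseteq y$ count as bounded. $\Delta_0^{\mathcal{P}}=\Sigma_0^{\mathcal{P}}=\Pi_0^{\mathcal{P}}$ is the set of formulae all of whose quantifiers are bounded in this sense; $\Sigma_{n+1}^{\mathcal{P}}$ consists of the formulae $\exists x\,.\,\phi$ with $\phi\in\Pi_n^{\mathcal{P}}$, and $\Pi_{n+1}^{\mathcal{P}}$ of the $\forall x\,.\,\phi$ with $\phi\in\Sigma_n^{\mathcal{P}}$ (all up to provable equivalence in the background theory). $\mathrm{KP}^{\mathcal{P}}$ is axiomatized by Extensionality, Pair, Union, Powerset, Infinity, $\Delta_0^{\mathcal{P}}$-Separation, $\Delta_0^{\mathcal{P}}$-Collection ($\forall u\in x\exists v\,\phi(u,v)\to\exists y\forall u\in x\exists v\in y\,\phi(u,v)$) and $\Pi_1^{\mathcal{P}}$-Foundation ($\exists x\,\phi(x)\to\exists y(\phi(y)\wedge\forall v\in y\,\neg\phi(v))$). It proves that each set has an ordinal rank. Models. A model is non-standard if its membership relation is not well-founded. $\mathcal{M}_\alpha=\{m\in\mathcal{M}\mid\mathcal{M}\models\mathrm{rank}(m)<\alpha\}$.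 A self-embedding of $\mathcal{M}$ is an injection $i:\mathcal{M}\to\mathcal{M}$ preserving and reflecting $\in$; it is rank-initial if every $n\in\mathcal{M}$ with $\mathrm{rank}^{\mathcal{M}}(n)\le\mathrm{rank}^{\mathcal{M}}(i(m))$ for some $m\in\mathcal{M}$ lies in $i(\mathcal{M})$. *)

theory Defs
  imports "HOL-Library.Countable_Set" "HOL-Library.FuncSet"
begin

section \<open>Formulae of the language of set theory\<close>

text \<open>Variables are de Bruijn indices: a quantifier binds index 0 and shifts all others up by one.\<close>

datatype fm =
    Mem nat nat
  | Eql nat nat
  | Neg fm
  | And fm fm
  | Or fm fm
  | Imp fm fm
  | Forall fm
  | Exists fm

text \<open>Structures are given by a carrier \<open>M\<close> and a membership relation \<open>E\<close>, where \<open>E x y\<close> is read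
  as: \<open>x\<close> is a member of \<open>y\<close>. Only the restriction of \<open>E\<close> to \<open>M\<close> matters. The assignment
  \<open>case_nat x e\<close> sends index 0 to \<open>x\<close> and index \<open>Suc n\<close> to \<open>e n\<close>.\<close>

primrec sat :: "'a set \<Rightarrow> ('a \<Rightarrow> 'a \<Rightarrow> bool) \<Rightarrow> (nat \<Rightarrow> 'a) \<Rightarrow> fm \<Rightarrow> bool" where
  "sat M E e (Mem i j) \<longleftrightarrow> E (e i) (e j)"
| "sat M E e (Eql i j) \<longleftrightarrow> e i = e j"
| "sat M E e (Neg p) \<longleftrightarrow> \<not> sat M E e p"
| "sat M E e (And p q) \<longleftrightarrow> sat M E e p \<and> sat M E e q"
| "sat M E e (Or p q) \<longleftrightarrow> sat M E e p \<or> sat M E e q"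
| "sat M E e (Imp p q) \<longleftrightarrow> (sat M E e p \<longrightarrow> sat M E e q)"
| "sat M E e (Forall p) \<longleftrightarrow> (\<forall>x\<in>M. sat M E (case_nat x e) p)"
| "sat M E e (Exists p) \<longleftrightarrow> (\<exists>x\<in>M. sat M E (case_nat x e) p)"

definition Sub :: "nat \<Rightarrow> nat \<Rightarrow> fm" where
  "Sub i j = Forall (Imp (Mem 0 (Suc i)) (Mem 0 (Suc j)))"

text \<open>Bounded quantifiers. The bound \<open>y\<close> is an index in the context outside the quantifier, so it
  is never the quantified variable itself.\<close>

definition Exists_mem :: "nat \<Rightarrow> fm \<Rightarrow> fm" where
  "Exists_mem y p = Exists (And (Mem 0 (Suc y)) p)"

definition Forall_mem :: "nat \<Rightarrow> fm \<Rightarrow> fm" where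
  "Forall_mem y p = Forall (Imp (Mem 0 (Suc y)) p)"

definition Exists_sub :: "nat \<Rightarrow> fm \<Rightarrow> fm" where
  "Exists_sub y p = Exists (And (Sub 0 (Suc y)) p)"

definition Forall_sub :: "nat \<Rightarrow> fm \<Rightarrow> fm" where
  "Forall_sub y p = Forall (Imp (Sub 0 (Suc y)) p)"

lemma sat_bounded [simp]:
  "sat M E e (Sub i j) \<longleftrightarrow> (\<forall>x\<in>M. E x (e i) \<longrightarrow> E x (e j))"
  "sat M E e (Exists_mem y p) \<longleftrightarrow> (\<exists>x\<in>M. E x (e y) \<and> sat M E (case_nat x e) p)"
  "sat M E e (Forall_mem y p) \<longleftrightarrow> (\<forall>x\<in>M. E x (e y) \<longrightarrow> sat M E (case_nat x e) p)"
  "sat M E e (Exists_sub y p) \<longleftrightarrow>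
     (\<exists>x\<in>M. (\<forall>z\<in>M. E z x \<longrightarrow> E z (e y)) \<and> sat M E (case_nat x e) p)"
  "sat M E e (Forall_sub y p) \<longleftrightarrow>
     (\<forall>x\<in>M. (\<forall>z\<in>M. E z x \<longrightarrow> E z (e y)) \<longrightarrow> sat M E (case_nat x e) p)"
  by (simp_all add: Sub_def Exists_mem_def Forall_mem_def Exists_sub_def Forall_sub_def)


section \<open>The Takahashi hierarchy\<close>

inductive_set Delta0P :: "fm set" where
  "Mem i j \<in> Delta0P"
| "Eql i j \<in> Delta0P"
| "p \<in> Delta0P \<Longrightarrow> Neg p \<in> Delta0P"
| "p \<in> Delta0P \<Longrightarrow> q \<in> Delta0P \<Longrightarrow> And p q \<in> Delta0P"
| "p \<in> Delta0P \<Longrightarrow> q \<in> Delta0P \<Longrightarrow> Or p q \<in> Delta0P"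
| "p \<in> Delta0P \<Longrightarrow> q \<in> Delta0P \<Longrightarrow> Imp p q \<in> Delta0P"
| "p \<in> Delta0P \<Longrightarrow> Exists_mem y p \<in> Delta0P"
| "p \<in> Delta0P \<Longrightarrow> Forall_mem y p \<in> Delta0P"
| "p \<in> Delta0P \<Longrightarrow> Exists_sub y p \<in> Delta0P"
| "p \<in> Delta0P \<Longrightarrow> Forall_sub y p \<in> Delta0P"

text \<open>The classes are syntactic. Closing them under provable equivalence in a theory does not change
  which instances of a schema hold in a model of that theory.\<close>

fun SigmaP :: "nat \<Rightarrow> fm set" and PiP :: "nat \<Rightarrow> fm set" where
  "SigmaP 0 = Delta0P"
| "PiP 0 = Delta0P"
| "SigmaP (Suc n) = Exists ` PiP n"
| "PiP (Suc n) = Forall ` SigmaP n"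


section \<open>Axioms\<close>

definition extensionality :: "'a set \<Rightarrow> ('a \<Rightarrow> 'a \<Rightarrow> bool) \<Rightarrow> bool" where
  "extensionality M E \<longleftrightarrow> (\<forall>x\<in>M. \<forall>y\<in>M. (\<forall>z\<in>M. E z x \<longleftrightarrow> E z y) \<longrightarrow> x = y)"

definition pairing :: "'a set \<Rightarrow> ('a \<Rightarrow> 'a \<Rightarrow> bool) \<Rightarrow> bool" where
  "pairing M E \<longleftrightarrow> (\<forall>x\<in>M. \<forall>y\<in>M. \<exists>z\<in>M. \<forall>t\<in>M. E t z \<longleftrightarrow> t = x \<or> t = y)"

definition union_axiom :: "'a set \<Rightarrow> ('a \<Rightarrow> 'a \<Rightarrow> bool) \<Rightarrow> bool" where
  "union_axiom M E \<longleftrightarrow> (\<forall>x\<in>M. \<exists>y\<in>M. \<forall>t\<in>M. E t y \<longleftrightarrow> (\<exists>z\<in>M. E z x \<and> E t z))"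

definition powerset :: "'a set \<Rightarrow> ('a \<Rightarrow> 'a \<Rightarrow> bool) \<Rightarrow> bool" where
  "powerset M E \<longleftrightarrow> (\<forall>x\<in>M. \<exists>y\<in>M. \<forall>t\<in>M. E t y \<longleftrightarrow> (\<forall>z\<in>M. E z t \<longrightarrow> E z x))"

definition infinity :: "'a set \<Rightarrow> ('a \<Rightarrow> 'a \<Rightarrow> bool) \<Rightarrow> bool" where
  "infinity M E \<longleftrightarrow> (\<exists>w\<in>M.
     (\<exists>z\<in>M. E z w \<and> (\<forall>t\<in>M. \<not> E t z)) \<and>
     (\<forall>y\<in>M. E y w \<longrightarrow> (\<exists>s\<in>M. E s w \<and> (\<forall>t\<in>M. E t s \<longleftrightarrow> E t y \<or> t = y))))"

text \<open>In the schemata the assignment \<open>e\<close> supplies the parameters of the formula.\<close>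

definition separation :: "fm set \<Rightarrow> 'a set \<Rightarrow> ('a \<Rightarrow> 'a \<Rightarrow> bool) \<Rightarrow> bool" where
  "separation \<Gamma> M E \<longleftrightarrow> (\<forall>p\<in>\<Gamma>. \<forall>e\<in>UNIV \<rightarrow> M. \<forall>x\<in>M. \<exists>y\<in>M. \<forall>z\<in>M.
     E z y \<longleftrightarrow> E z x \<and> sat M E (case_nat z e) p)"

definition collection :: "fm set \<Rightarrow> 'a set \<Rightarrow> ('a \<Rightarrow> 'a \<Rightarrow> bool) \<Rightarrow> bool" where
  "collection \<Gamma> M E \<longleftrightarrow> (\<forall>p\<in>\<Gamma>. \<forall>e\<in>UNIV \<rightarrow> M. \<forall>x\<in>M.
     (\<forall>u\<in>M. E u x \<longrightarrow> (\<exists>v\<in>M. sat M E (case_nat u (case_nat v e)) p)) \<longrightarrow>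
     (\<exists>y\<in>M. \<forall>u\<in>M. E u x \<longrightarrow> (\<exists>v\<in>M. E v y \<and> sat M E (case_nat u (case_nat v e)) p)))"

definition foundation :: "fm set \<Rightarrow> 'a set \<Rightarrow> ('a \<Rightarrow> 'a \<Rightarrow> bool) \<Rightarrow> bool" where
  "foundation \<Gamma> M E \<longleftrightarrow> (\<forall>p\<in>\<Gamma>. \<forall>e\<in>UNIV \<rightarrow> M.
     (\<exists>x\<in>M. sat M E (case_nat x e) p) \<longrightarrow>
     (\<exists>y\<in>M. sat M E (case_nat y e) p \<and> (\<forall>v\<in>M. E v y \<longrightarrow> \<not> sat M E (case_nat v e) p)))"

definition models_KPP :: "'a set \<Rightarrow> ('a \<Rightarrow> 'a \<Rightarrow> bool) \<Rightarrow> bool" where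
  "models_KPP M E \<longleftrightarrow>
     extensionality M E \<and> pairing M E \<and> union_axiom M E \<and> powerset M E \<and> infinity M E \<and>
     separation Delta0P M E \<and> collection Delta0P M E \<and> foundation (PiP 1) M E"

definition nonstandard :: "'a set \<Rightarrow> ('a \<Rightarrow> 'a \<Rightarrow> bool) \<Rightarrow> bool" where
  "nonstandard M E \<longleftrightarrow> \<not> wfp_on M E"


section \<open>Ordinals and ranks inside a model\<close>

definition transitive_in :: "'a set \<Rightarrow> ('a \<Rightarrow> 'a \<Rightarrow> bool) \<Rightarrow> 'a \<Rightarrow> bool" where
  "transitive_in M E d \<longleftrightarrow> (\<forall>x\<in>M. \<forall>y\<in>M. E x y \<longrightarrow> E y d \<longrightarrow> E x d)"

text \<open>Well-ordering by membership is replaced by linear ordering, as usual in the presence of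
  Foundation.\<close>

definition Ord_in :: "'a set \<Rightarrow> ('a \<Rightarrow> 'a \<Rightarrow> bool) \<Rightarrow> 'a set" where
  "Ord_in M E = {a \<in> M. transitive_in M E a \<and>
     (\<forall>x\<in>M. \<forall>y\<in>M. E x a \<longrightarrow> E y a \<longrightarrow> E x y \<or> x = y \<or> E y x)}"

definition is_upair :: "'a set \<Rightarrow> ('a \<Rightarrow> 'a \<Rightarrow> bool) \<Rightarrow> 'a \<Rightarrow> 'a \<Rightarrow> 'a \<Rightarrow> bool" where
  "is_upair M E p x y \<longleftrightarrow> (\<forall>t\<in>M. E t p \<longleftrightarrow> t = x \<or> t = y)"

text \<open>Kuratowski pairs\<close>

definition is_opair :: "'a set \<Rightarrow> ('a \<Rightarrow> 'a \<Rightarrow> bool) \<Rightarrow> 'a \<Rightarrow> 'a \<Rightarrow> 'a \<Rightarrow> bool" where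
  "is_opair M E p x y \<longleftrightarrow>
     (\<exists>a\<in>M. \<exists>b\<in>M. is_upair M E a x x \<and> is_upair M E b x y \<and> is_upair M E p a b)"

definition maps_to :: "'a set \<Rightarrow> ('a \<Rightarrow> 'a \<Rightarrow> bool) \<Rightarrow> 'a \<Rightarrow> 'a \<Rightarrow> 'a \<Rightarrow> bool" where
  "maps_to M E f x y \<longleftrightarrow> (\<exists>p\<in>M. E p f \<and> is_opair M E p x y)"

definition function_on :: "'a set \<Rightarrow> ('a \<Rightarrow> 'a \<Rightarrow> bool) \<Rightarrow> 'a \<Rightarrow> 'a \<Rightarrow> bool" where
  "function_on M E f d \<longleftrightarrow>
     (\<forall>p\<in>M. E p f \<longrightarrow> (\<exists>x\<in>M. \<exists>y\<in>M. E x d \<and> is_opair M E p x y)) \<and>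
     (\<forall>x\<in>M. E x d \<longrightarrow> (\<exists>!y. y \<in> M \<and> maps_to M E f x y))"

text \<open>An element \<open>f\<close> of the model which the model takes to be a function on the transitive set \<open>d\<close>
  satisfying the recursion \<open>f x = sup {f z + 1 | z \<in> x}\<close>, that is, the union of the sets
  \<open>f z \<union> {f z}\<close> for \<open>z \<in> x\<close>.\<close>

definition rank_function :: "'a set \<Rightarrow> ('a \<Rightarrow> 'a \<Rightarrow> bool) \<Rightarrow> 'a \<Rightarrow> 'a \<Rightarrow> bool" where
  "rank_function M E f d \<longleftrightarrow> transitive_in M E d \<and> function_on M E f d \<and>
     (\<forall>x\<in>M. \<forall>y\<in>M. E x d \<longrightarrow> maps_to M E f x y \<longrightarrow>
        (\<forall>t\<in>M. E t y \<longleftrightarrow> (\<exists>z\<in>M. \<exists>w\<in>M. E z x \<and> maps_to M E f z w \<and> (E t w \<or> t = w))))"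

definition has_rank :: "'a set \<Rightarrow> ('a \<Rightarrow> 'a \<Rightarrow> bool) \<Rightarrow> 'a \<Rightarrow> 'a \<Rightarrow> bool" where
  "has_rank M E x \<alpha> \<longleftrightarrow> (\<exists>f\<in>M. \<exists>d\<in>M. rank_function M E f d \<and> E x d \<and> maps_to M E f x \<alpha>)"

text \<open>In a model of \<open>KP\<^sup>P\<close> every element has exactly one rank, and it is an ordinal of the model.\<close>

definition rank :: "'a set \<Rightarrow> ('a \<Rightarrow> 'a \<Rightarrow> bool) \<Rightarrow> 'a \<Rightarrow> 'a" where
  "rank M E x = (THE \<alpha>. \<alpha> \<in> M \<and> has_rank M E x \<alpha>)"

definition below_rank :: "'a set \<Rightarrow> ('a \<Rightarrow> 'a \<Rightarrow> bool) \<Rightarrow> 'a \<Rightarrow> 'a set" where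
  "below_rank M E \<alpha> = {m \<in> M. E (rank M E m) \<alpha>}"


section \<open>Self-embeddings\<close>

definition self_embedding :: "'a set \<Rightarrow> ('a \<Rightarrow> 'a \<Rightarrow> bool) \<Rightarrow> ('a \<Rightarrow> 'a) \<Rightarrow> bool" where
  "self_embedding M E i \<longleftrightarrow> i \<in> M \<rightarrow> M \<and> inj_on i M \<and> (\<forall>x\<in>M. \<forall>y\<in>M. E x y \<longleftrightarrow> E (i x) (i y))"

definition rank_initial :: "'a set \<Rightarrow> ('a \<Rightarrow> 'a \<Rightarrow> bool) \<Rightarrow> ('a \<Rightarrow> 'a) \<Rightarrow> bool" where
  "rank_initial M E i \<longleftrightarrow> (\<forall>n\<in>M. \<forall>m\<in>M.
     E (rank M E n) (rank M E (i m)) \<or> rank M E n = rank M E (i m) \<longrightarrow> n \<in> i ` M)"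

end

theory Submission
  imports Defs
begin

text \<open>
  From embeddings to separation. Let \<open>i\<close> be a proper rank-initial self-embedding. Its range is
  closed under elements and subsets, so \<open>i\<close> preserves all bounded formulae
  (\<open>delta0_elementary\<close>), and it is contained in one level \<open>V\<close> of the cumulative hierarchy, namely
  the level at the rank of any point outside the range. If \<open>i\<close> moreover fixes the parameters and all
  elements of \<open>x\<close>, then a witness \<open>w\<close> of a bounded formula at \<open>z \<in> x\<close> can be replaced by the
  witness \<open>i w \<in> V\<close>. So an existential quantifier in front of a bounded formula can be bounded by
  \<open>V\<close>, and bounded separation suffices (\<open>separation_if_embeddings\<close>).

  From separation to embeddings. The embedding is built by back and forth as a map that preserves
  \<open>\<Sigma>\<^sub>1\<close> properties into a single set of the model. These properties are given not by formulae but by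
  infinitary codes, which are elements of the model. A code \<open>\<langle>c, \<langle>d, D\<rangle>\<rangle>\<close> is read at an assignment
  \<open>e\<close> of values to names, which is also an element of the model. If both names have
  values, it is the atom ``the value of \<open>c\<close> is an element of the value of \<open>d\<close>'' or its negation. If
  only \<open>d\<close> has a value \<open>v\<close>, it says that for every element or subset \<open>y\<close> of \<open>v\<close>, some code in \<open>D\<close>
  holds once \<open>c\<close> is given the value \<open>y\<close>. If neither has a value, it says that some \<open>y\<close> makes all
  codes in \<open>D\<close> hold. A set \<open>W\<close> of pairs of a code and an assignment that contains, with each pair,
  enough further pairs to verify it (\<open>strategy\<close>) witnesses truth. So truth is a \<open>\<Sigma>\<^sub>1\<close> predicate
  (\<open>holds\<close>) without any recursion on codes, and unions of strategies are strategies.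

  By separation the codes in a given set \<open>P 0\<close> that hold at the initial assignment form a set, and by
  collection one strategy \<open>W\<close> verifies all of them. Stage \<open>k\<close> maintains two assignments \<open>e\<close> and \<open>e'\<close>
  with the same names such that every code in \<open>P k\<close> that holds at \<open>e\<close> is verified by \<open>W\<close> at \<open>e'\<close>
  (\<open>simulates\<close>). To continue, all codes in \<open>P (k + 1)\<close> that hold after a new value is added on one
  side, or are not verified after one is added on the other side, are collected in a set \<open>D\<close>, and a
  single code in \<open>P k\<close> built from \<open>D\<close> yields the corresponding value on the other side
  (\<open>forth_step\<close>, \<open>back_step\<close>). This needs sets such that codes built from \<open>D \<subseteq> P (k + 1)\<close> are
  in \<open>P k\<close>: here non-standardness enters. Along an infinite descending sequence \<open>y 0, y 1, \<dots>\<close> the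
  level of the cumulative hierarchy at \<open>y k\<close> contains all subsets of the level at \<open>y (k + 1)\<close>, so
  every fifth of these levels will do. If the hierarchy is started from a set \<open>s\<close>
  instead of the empty set, all elements of \<open>s\<close> can serve as names of themselves throughout, which
  makes the embedding fix \<open>s\<close> pointwise. All values on the right lie in the transitive closure of \<open>W\<close>,
  so the embedding is proper. Its range is closed under elements and subsets, and as the function that
  sends \<open>m\<close> to the level at \<open>m\<close> is preserved by bounded elementarity, the embedding is rank-initial
  (\<open>rank_initial_if_closed\<close>).
\<close>

section \<open>Renaming of variables\<close>

text \<open>A definable predicate remains definable when its variables are renamed. This serves to insert
  further variables into the context of a predicate.\<close>

primrec rename_fm :: "(nat \<Rightarrow> nat) \<Rightarrow> fm \<Rightarrow> fm" where
  "rename_fm r (Mem i j) = Mem (r i) (r j)"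
| "rename_fm r (Eql i j) = Eql (r i) (r j)"
| "rename_fm r (Neg p) = Neg (rename_fm r p)"
| "rename_fm r (And p q) = And (rename_fm r p) (rename_fm r q)"
| "rename_fm r (Or p q) = Or (rename_fm r p) (rename_fm r q)"
| "rename_fm r (Imp p q) = Imp (rename_fm r p) (rename_fm r q)"
| "rename_fm r (Forall p) = Forall (rename_fm (case_nat 0 (Suc \<circ> r)) p)"
| "rename_fm r (Exists p) = Exists (rename_fm (case_nat 0 (Suc \<circ> r)) p)"

lemma case_nat_lift: "(\<lambda>n. case_nat x e (case_nat 0 (Suc \<circ> r) n)) = case_nat x (\<lambda>n. e (r n))"
  by (auto simp: fun_eq_iff split: nat.split)

lemma sat_rename_fm: "sat M E e (rename_fm r p) \<longleftrightarrow> sat M E (\<lambda>n. e (r n)) p"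
  by (induction p arbitrary: e r) (simp_all add: case_nat_lift)

lemma rename_fm_Delta0P: "p \<in> Delta0P \<Longrightarrow> rename_fm r p \<in> Delta0P"
proof (induction arbitrary: r rule: Delta0P.induct)
  case (7 p y)
  have "rename_fm r (Exists_mem y p) = Exists_mem (r y) (rename_fm (case_nat 0 (Suc \<circ> r)) p)"
    by (simp add: Exists_mem_def)
  then show ?case using 7 by (simp add: Delta0P.intros)
next
  case (8 p y)
  have "rename_fm r (Forall_mem y p) = Forall_mem (r y) (rename_fm (case_nat 0 (Suc \<circ> r)) p)"
    by (simp add: Forall_mem_def)
  then show ?case using 8 by (simp add: Delta0P.intros)
next
  case (9 p y)
  have "rename_fm r (Exists_sub y p) = Exists_sub (r y) (rename_fm (case_nat 0 (Suc \<circ> r)) p)"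
    by (simp add: Exists_sub_def Sub_def)
  then show ?case using 9 by (simp add: Delta0P.intros)
next
  case (10 p y)
  have "rename_fm r (Forall_sub y p) = Forall_sub (r y) (rename_fm (case_nat 0 (Suc \<circ> r)) p)"
    by (simp add: Forall_sub_def Sub_def)
  then show ?case using 10 by (simp add: Delta0P.intros)
qed (simp_all add: Delta0P.intros)

section \<open>Definable predicates\<close>

text \<open>The carrier is a whole type; the last section reduces the general case to this one.\<close>

locale kpp =
  fixes E :: "'a \<Rightarrow> 'a \<Rightarrow> bool" (infix "\<epsilon>" 50)
  assumes models: "models_KPP UNIV E"
begin

definition subs (infix "\<sqsubseteq>" 50) where
  "x \<sqsubseteq> y \<longleftrightarrow> (\<forall>z. z \<epsilon> x \<longrightarrow> z \<epsilon> y)"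

text \<open>Definability is treated semantically: the predicates on assignments that some bounded formula
  defines in the model. Closure properties then replace the manipulation of concrete formulae.\<close>

definition delta0 :: "((nat \<Rightarrow> 'a) \<Rightarrow> bool) \<Rightarrow> bool" where
  "delta0 R \<longleftrightarrow> (\<exists>p\<in>Delta0P. \<forall>e. sat UNIV E e p \<longleftrightarrow> R e)"

lemma delta0_rename: "delta0 R \<Longrightarrow> delta0 (\<lambda>e. R (\<lambda>n. e (r n)))"
  unfolding delta0_def using rename_fm_Delta0P
  by (metis sat_rename_fm)

lemma delta0_subst: "delta0 (\<lambda>e. R (e 0) (\<lambda>n. e (Suc n))) \<Longrightarrow> delta0 (\<lambda>e. R (e i) e)"
  using delta0_rename[of "\<lambda>e. R (e 0) (\<lambda>n. e (Suc n))" "case_nat i id"] by simp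

lemma delta0_mem: "delta0 (\<lambda>e. e i \<epsilon> e j)"
  unfolding delta0_def by (rule bexI[of _ "Mem i j"]) (simp_all add: Delta0P.intros)

lemma delta0_eq: "delta0 (\<lambda>e. e i = e j)"
  unfolding delta0_def by (rule bexI[of _ "Eql i j"]) (simp_all add: Delta0P.intros)

lemma delta0_not: "delta0 R \<Longrightarrow> delta0 (\<lambda>e. \<not> R e)"
  unfolding delta0_def using Delta0P.intros(3) by (metis sat.simps(3))

lemma delta0_conj: "delta0 R \<Longrightarrow> delta0 S \<Longrightarrow> delta0 (\<lambda>e. R e \<and> S e)"
  unfolding delta0_def using Delta0P.intros(4) by (metis sat.simps(4))

lemma delta0_disj: "delta0 R \<Longrightarrow> delta0 S \<Longrightarrow> delta0 (\<lambda>e. R e \<or> S e)"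
  unfolding delta0_def using Delta0P.intros(5) by (metis sat.simps(5))

lemma delta0_imp: "delta0 R \<Longrightarrow> delta0 S \<Longrightarrow> delta0 (\<lambda>e. R e \<longrightarrow> S e)"
  unfolding delta0_def using Delta0P.intros(6) by (metis sat.simps(6))

text \<open>The quantifier rules have a named variable \<open>x\<close> where a formula has index 0. As \<open>R\<close> and \<open>x\<close>
  are bound by higher-order patterns, a definability goal for an explicit predicate is solved by
  resolving with these rules.\<close>

lemma delta0_ex_mem:
  assumes "delta0 (\<lambda>e. R (e 0) (\<lambda>n. e (Suc n)))"
  shows "delta0 (\<lambda>e. \<exists>x. x \<epsilon> e i \<and> R x e)"
proof -
  from assms obtain p where "p \<in> Delta0P" "\<And>e. sat UNIV E e p \<longleftrightarrow> R (e 0) (\<lambda>n. e (Suc n))"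
    unfolding delta0_def by blast
  then show ?thesis unfolding delta0_def
    by (intro bexI[of _ "Exists_mem i p"]) (simp_all add: Delta0P.intros)
qed

lemma delta0_all_mem:
  assumes "delta0 (\<lambda>e. R (e 0) (\<lambda>n. e (Suc n)))"
  shows "delta0 (\<lambda>e. \<forall>x. x \<epsilon> e i \<longrightarrow> R x e)"
proof -
  from assms obtain p where "p \<in> Delta0P" "\<And>e. sat UNIV E e p \<longleftrightarrow> R (e 0) (\<lambda>n. e (Suc n))"
    unfolding delta0_def by blast
  then show ?thesis unfolding delta0_def
    by (intro bexI[of _ "Forall_mem i p"]) (simp_all add: Delta0P.intros)
qed

lemma delta0_all_subs:
  assumes "delta0 (\<lambda>e. R (e 0) (\<lambda>n. e (Suc n)))"
  shows "delta0 (\<lambda>e. \<forall>x. x \<sqsubseteq> e i \<longrightarrow> R x e)"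
proof -
  from assms obtain p where "p \<in> Delta0P" "\<And>e. sat UNIV E e p \<longleftrightarrow> R (e 0) (\<lambda>n. e (Suc n))"
    unfolding delta0_def by blast
  then show ?thesis unfolding delta0_def subs_def
    by (intro bexI[of _ "Forall_sub i p"]) (simp_all add: Delta0P.intros)
qed

lemma delta0_subs: "delta0 (\<lambda>e. e i \<sqsubseteq> e j)"
  unfolding subs_def by (intro delta0_all_mem delta0_mem)

text \<open>One existential quantifier in front of a bounded predicate, as in \<open>SigmaP 1\<close>. Closure under
  further existential quantifiers uses the bound \<open>{x, y}\<close> for two witnesses \<open>x\<close> and \<open>y\<close>.\<close>

definition sigma1 :: "((nat \<Rightarrow> 'a) \<Rightarrow> bool) \<Rightarrow> bool" where
  "sigma1 R \<longleftrightarrow> (\<exists>S. delta0 S \<and> (\<forall>e. R e \<longleftrightarrow> (\<exists>x. S (case_nat x e))))"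

lemma ext: "(\<And>z. z \<epsilon> x \<longleftrightarrow> z \<epsilon> y) \<Longrightarrow> x = y"
  using models unfolding models_KPP_def extensionality_def by simp

definition upair :: "'a \<Rightarrow> 'a \<Rightarrow> 'a" where
  "upair x y = (SOME z. \<forall>t. t \<epsilon> z \<longleftrightarrow> t = x \<or> t = y)"

lemma mem_upair [simp]: "t \<epsilon> upair x y \<longleftrightarrow> t = x \<or> t = y"
proof -
  have "\<exists>z. \<forall>t. t \<epsilon> z \<longleftrightarrow> t = x \<or> t = y"
    using models unfolding models_KPP_def pairing_def by simp
  from someI_ex[OF this] show ?thesis unfolding upair_def by blast
qed

definition bigunion :: "'a \<Rightarrow> 'a" where
  "bigunion x = (SOME y. \<forall>t. t \<epsilon> y \<longleftrightarrow> (\<exists>z. z \<epsilon> x \<and> t \<epsilon> z))"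

lemma mem_bigunion [simp]: "t \<epsilon> bigunion x \<longleftrightarrow> (\<exists>z. z \<epsilon> x \<and> t \<epsilon> z)"
proof -
  have "\<exists>y. \<forall>t. t \<epsilon> y \<longleftrightarrow> (\<exists>z. z \<epsilon> x \<and> t \<epsilon> z)"
    using models unfolding models_KPP_def union_axiom_def by simp
  from someI_ex[OF this] show ?thesis unfolding bigunion_def by blast
qed

definition pow :: "'a \<Rightarrow> 'a" where
  "pow x = (SOME y. \<forall>t. t \<epsilon> y \<longleftrightarrow> t \<sqsubseteq> x)"

lemma mem_pow [simp]: "t \<epsilon> pow x \<longleftrightarrow> t \<sqsubseteq> x"
proof -
  have "\<exists>y. \<forall>t. t \<epsilon> y \<longleftrightarrow> t \<sqsubseteq> x"
    using models unfolding models_KPP_def powerset_def subs_def by simp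
  from someI_ex[OF this] show ?thesis unfolding pow_def by blast
qed

definition union :: "'a \<Rightarrow> 'a \<Rightarrow> 'a" where
  "union x y = bigunion (upair x y)"

lemma mem_union [simp]: "t \<epsilon> union x y \<longleftrightarrow> t \<epsilon> x \<or> t \<epsilon> y"
  unfolding union_def by auto

definition empty :: 'a where
  "empty = (SOME z. \<forall>t. \<not> t \<epsilon> z)"

lemma mem_empty [simp]: "\<not> t \<epsilon> empty"
proof -
  have "\<exists>z. \<forall>t. \<not> t \<epsilon> z"
    using models unfolding models_KPP_def infinity_def by simp blast
  from someI_ex[OF this] show ?thesis unfolding empty_def by blast
qed

text \<open>Assignments are given by lists of parameters; the values beyond the length of the list do
  not matter, as every value belongs to the carrier.\<close>

lemma case_nat_nth: "case_nat x ((!) xs) = (!) (x # xs)"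
  by (auto simp: fun_eq_iff split: nat.split)

lemma separation0:
  assumes "delta0 R"
  shows "\<exists>y. \<forall>z. z \<epsilon> y \<longleftrightarrow> z \<epsilon> x \<and> R ((!) (z # ps))"
proof -
  from assms obtain p where p: "p \<in> Delta0P" "\<And>e. sat UNIV E e p \<longleftrightarrow> R e"
    unfolding delta0_def by blast
  have "separation Delta0P UNIV E" using models unfolding models_KPP_def by simp
  with p(1) have "\<exists>y. \<forall>z. z \<epsilon> y \<longleftrightarrow> z \<epsilon> x \<and> sat UNIV E (case_nat z ((!) ps)) p"
    unfolding separation_def by simp
  then show ?thesis by (simp add: p case_nat_nth)
qed

lemma collection0:
  assumes "delta0 R" and "\<And>u. u \<epsilon> x \<Longrightarrow> \<exists>v. R ((!) (u # v # ps))"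
  shows "\<exists>y. \<forall>u. u \<epsilon> x \<longrightarrow> (\<exists>v. v \<epsilon> y \<and> R ((!) (u # v # ps)))"
proof -
  from assms obtain p where p: "p \<in> Delta0P" "\<And>e. sat UNIV E e p \<longleftrightarrow> R e"
    unfolding delta0_def by blast
  have "collection Delta0P UNIV E" using models unfolding models_KPP_def by simp
  with p(1) have "(\<forall>u. u \<epsilon> x \<longrightarrow> (\<exists>v. sat UNIV E (case_nat u (case_nat v ((!) ps))) p)) \<longrightarrow>
     (\<exists>y. \<forall>u. u \<epsilon> x \<longrightarrow> (\<exists>v. v \<epsilon> y \<and> sat UNIV E (case_nat u (case_nat v ((!) ps))) p))"
    unfolding collection_def by simp
  then show ?thesis using assms(2) by (simp add: p case_nat_nth)
qed

lemma sigma1_delta0: "delta0 R \<Longrightarrow> sigma1 R"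
  unfolding sigma1_def
  by (intro exI[of _ "\<lambda>e. R (\<lambda>n. e (Suc n))"] conjI, rule delta0_rename) simp_all

lemma sigma1_ex_delta0:
  assumes "delta0 (\<lambda>e. R (e 0) (\<lambda>n. e (Suc n)))"
  shows "sigma1 (\<lambda>e. \<exists>x. R x e)"
  using assms unfolding sigma1_def by (intro exI[of _ "\<lambda>e. R (e 0) (\<lambda>n. e (Suc n))"]) simp

lemma ex_pair_bounded: "(\<exists>x y. P x y) \<longleftrightarrow> (\<exists>h. \<exists>x. x \<epsilon> h \<and> (\<exists>y. y \<epsilon> h \<and> P x y))"
proof
  assume "\<exists>x y. P x y"
  then obtain x y where "P x y" by blast
  then show "\<exists>h. \<exists>x. x \<epsilon> h \<and> (\<exists>y. y \<epsilon> h \<and> P x y)"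
    by (intro exI[of _ "upair x y"] exI[of _ x] conjI exI[of _ y]) simp_all
qed blast

lemma sigma1_ex:
  assumes "sigma1 (\<lambda>e. R (e 0) (\<lambda>n. e (Suc n)))"
  shows "sigma1 (\<lambda>e. \<exists>x. R x e)"
proof -
  from assms obtain S where S: "delta0 S"
    and RS: "\<And>e. R (e 0) (\<lambda>n. e (Suc n)) \<longleftrightarrow> (\<exists>w. S (case_nat w e))"
    unfolding sigma1_def by blast
  have R: "R x e \<longleftrightarrow> (\<exists>w. S (case_nat w (case_nat x e)))" for x e
    using RS[of "case_nat x e"] by simp
  have "delta0 (\<lambda>e. S (case_nat (e 0) (case_nat (e 1) (\<lambda>n. e (Suc (Suc (Suc n)))))))"
  proof -
    have "case_nat (e 0) (case_nat (e 1) (\<lambda>n. e (Suc (Suc (Suc n))))) =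
        (\<lambda>n. e (case_nat 0 (case_nat 1 (\<lambda>n. Suc (Suc (Suc n)))) n))" for e :: "nat \<Rightarrow> 'a"
      by (auto simp: fun_eq_iff split: nat.split)
    then show ?thesis
      by (simp only: delta0_rename[OF S])
  qed
  then have "delta0 (\<lambda>e. \<exists>x. x \<epsilon> e 0 \<and> (\<exists>w. w \<epsilon> e 0 \<and>
      S (case_nat w (case_nat x (\<lambda>n. e (Suc n))))))"
    by (intro delta0_ex_mem) simp
  moreover have "(\<exists>x. R x e) \<longleftrightarrow> (\<exists>h. \<exists>x. x \<epsilon> h \<and> (\<exists>w. w \<epsilon> h \<and> S (case_nat w (case_nat x e))))" for e
    unfolding R by (rule ex_pair_bounded)
  ultimately show ?thesis unfolding sigma1_def
    by (intro exI[of _ "\<lambda>e. \<exists>x. x \<epsilon> e 0 \<and> (\<exists>w. w \<epsilon> e 0 \<and>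
      S (case_nat w (case_nat x (\<lambda>n. e (Suc n)))))"]) simp
qed

lemma sigma1_conj_delta0:
  assumes "sigma1 R" "delta0 T"
  shows "sigma1 (\<lambda>e. R e \<and> T e)"
proof -
  from assms(1) obtain S where S: "delta0 S" "\<And>e. R e \<longleftrightarrow> (\<exists>w. S (case_nat w e))"
    unfolding sigma1_def by blast
  have "delta0 (\<lambda>e. S e \<and> T (\<lambda>n. e (Suc n)))"
    by (rule delta0_conj[OF S(1) delta0_rename[OF assms(2)]])
  then show ?thesis unfolding sigma1_def
    by (intro exI[of _ "\<lambda>e. S e \<and> T (\<lambda>n. e (Suc n))"]) (simp add: S)
qed

lemma sigma1_conj:
  assumes "sigma1 R" "sigma1 T"
  shows "sigma1 (\<lambda>e. R e \<and> T e)"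
proof -
  from assms(2) obtain S where S: "delta0 S" "\<And>e. T e \<longleftrightarrow> (\<exists>w. S (case_nat w e))"
    unfolding sigma1_def by blast
  have eta: "case_nat (e 0) (\<lambda>n. e (Suc n)) = e" for e :: "nat \<Rightarrow> 'a"
    by (auto simp: fun_eq_iff split: nat.split)
  from assms(1) obtain S' where S': "delta0 S'" "\<And>e. R e \<longleftrightarrow> (\<exists>w. S' (case_nat w e))"
    unfolding sigma1_def by blast
  have "sigma1 (\<lambda>e. R (\<lambda>n. e (Suc n)))"
  proof -
    have "(\<lambda>n. e (case_nat 0 (\<lambda>n. Suc (Suc n)) n)) = case_nat (e 0) (\<lambda>n. e (Suc (Suc n)))"
      for e :: "nat \<Rightarrow> 'a" by (auto simp: fun_eq_iff split: nat.split)
    with delta0_rename[OF S'(1), of "case_nat 0 (\<lambda>n. Suc (Suc n))"]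
    have "delta0 (\<lambda>e. S' (case_nat (e 0) (\<lambda>n. e (Suc (Suc n)))))" by simp
    then show ?thesis unfolding S'(2) by (intro sigma1_ex_delta0)
  qed
  then have "sigma1 (\<lambda>e. \<exists>w. R e \<and> S (case_nat w e))"
    by (intro sigma1_ex sigma1_conj_delta0) (simp_all add: eta S)
  then show ?thesis by (simp add: S)
qed

lemma separation1:
  assumes "separation (SigmaP 1) UNIV E" and "sigma1 R"
  shows "\<exists>y. \<forall>z. z \<epsilon> y \<longleftrightarrow> z \<epsilon> x \<and> R ((!) (z # ps))"
proof -
  from assms(2) obtain S where S: "delta0 S" "\<And>e. R e \<longleftrightarrow> (\<exists>w. S (case_nat w e))"
    unfolding sigma1_def by blast
  from S(1) obtain p where p: "p \<in> Delta0P" "\<And>e. sat UNIV E e p \<longleftrightarrow> S e"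
    unfolding delta0_def by blast
  have "Exists p \<in> SigmaP 1" using p by simp
  with assms(1) have "\<forall>e\<in>UNIV \<rightarrow> UNIV. \<forall>x\<in>UNIV. \<exists>y\<in>UNIV. \<forall>z\<in>UNIV.
     E z y \<longleftrightarrow> E z x \<and> sat UNIV E (case_nat z e) (Exists p)"
    unfolding separation_def by (rule bspec)
  then have "\<exists>y. \<forall>z. z \<epsilon> y \<longleftrightarrow> z \<epsilon> x \<and> R (case_nat z ((!) ps))" by (simp add: S p)
  then show ?thesis unfolding case_nat_nth .
qed

text \<open>The negation of a \<open>\<Sigma>\<^sub>1\<close> predicate is \<open>\<Pi>\<^sub>1\<close>, so \<open>\<Pi>\<^sub>1\<close>-Foundation is membership induction for
  \<open>\<Sigma>\<^sub>1\<close> predicates.\<close>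

lemma sigma1_induct:
  assumes "sigma1 R" and step: "\<And>x. (\<And>z. z \<epsilon> x \<Longrightarrow> R ((!) (z # ps))) \<Longrightarrow> R ((!) (x # ps))"
  shows "R ((!) (x # ps))"
proof -
  from assms(1) obtain S where S: "delta0 S" "\<And>e. R e \<longleftrightarrow> (\<exists>w. S (case_nat w e))"
    unfolding sigma1_def by blast
  from delta0_not[OF S(1)] obtain p where p: "p \<in> Delta0P" "\<And>e. sat UNIV E e p \<longleftrightarrow> \<not> S e"
    unfolding delta0_def by blast
  have *: "sat UNIV E e (Forall p) \<longleftrightarrow> \<not> R e" for e by (simp add: S p)
  have "foundation (PiP 1) UNIV E" using models unfolding models_KPP_def by simp
  moreover have "Forall p \<in> PiP 1" using p by simp
  ultimately have "\<forall>e\<in>UNIV \<rightarrow> UNIV. (\<exists>x\<in>UNIV. sat UNIV E (case_nat x e) (Forall p)) \<longrightarrow>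
     (\<exists>y\<in>UNIV. sat UNIV E (case_nat y e) (Forall p) \<and>
       (\<forall>v\<in>UNIV. v \<epsilon> y \<longrightarrow> \<not> sat UNIV E (case_nat v e) (Forall p)))"
    unfolding foundation_def by (rule bspec)
  then have "(\<exists>x. \<not> R (case_nat x ((!) ps))) \<longrightarrow>
     (\<exists>y. \<not> R (case_nat y ((!) ps)) \<and> (\<forall>v. v \<epsilon> y \<longrightarrow> R (case_nat v ((!) ps))))"
    unfolding * by simp
  then show ?thesis unfolding case_nat_nth using step by blast
qed

lemma not_mem_self [simp]: "\<not> x \<epsilon> x"
proof -
  have "\<not> ((!) (x # [])) 0 \<epsilon> ((!) (x # [])) 0"
    by (rule sigma1_induct[of "\<lambda>e. \<not> e 0 \<epsilon> e 0"])
      (intro sigma1_delta0 delta0_not delta0_mem, force)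
  then show ?thesis by simp
qed

definition kpair :: "'a \<Rightarrow> 'a \<Rightarrow> 'a" ("\<langle>_,/ _\<rangle>") where
  "\<langle>x, y\<rangle> = upair (upair x x) (upair x y)"

lemma upair_eq_iff: "p = upair x y \<longleftrightarrow> (\<forall>t. t \<epsilon> p \<longleftrightarrow> t = x \<or> t = y)"
  by (auto intro: ext)

lemma upair_inject: "upair x y = upair x' y' \<longleftrightarrow> x = x' \<and> y = y' \<or> x = y' \<and> y = x'"
  unfolding upair_eq_iff mem_upair by metis

lemma kpair_inject [simp]: "\<langle>x, y\<rangle> = \<langle>x', y'\<rangle> \<longleftrightarrow> x = x' \<and> y = y'"
  unfolding kpair_def upair_inject by auto

lemma is_opair_iff [simp]: "is_opair UNIV E p x y \<longleftrightarrow> p = \<langle>x, y\<rangle>"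
proof -
  have "is_upair UNIV E p x y \<longleftrightarrow> p = upair x y" for p x y
    unfolding is_upair_def upair_eq_iff by simp
  then show ?thesis unfolding is_opair_def kpair_def by simp
qed

lemma maps_to_iff [simp]: "maps_to UNIV E f x y \<longleftrightarrow> \<langle>x, y\<rangle> \<epsilon> f"
  unfolding maps_to_def by auto

lemma kpair_mem_field:
  assumes "\<langle>x, y\<rangle> \<epsilon> f"
  shows "x \<epsilon> bigunion (bigunion f)" "y \<epsilon> bigunion (bigunion f)"
proof -
  have "upair x y \<epsilon> \<langle>x, y\<rangle>" unfolding kpair_def by simp
  then have "upair x y \<epsilon> bigunion f" using assms mem_bigunion by blast
  then show "x \<epsilon> bigunion (bigunion f)" "y \<epsilon> bigunion (bigunion f)"
    using mem_bigunion[of _ "bigunion f"] mem_upair by blast+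
qed

lemma delta0_eq_upair: "delta0 (\<lambda>e. e i = upair (e j) (e k))"
proof -
  have *: "p = upair x y \<longleftrightarrow> x \<epsilon> p \<and> y \<epsilon> p \<and> (\<forall>t. t \<epsilon> p \<longrightarrow> t = x \<or> t = y)" for p x y
    by (auto intro: ext)
  show ?thesis unfolding *
    by (intro delta0_conj delta0_all_mem delta0_disj delta0_mem delta0_eq)
qed

lemma delta0_eq_kpair: "delta0 (\<lambda>e. e i = \<langle>e j, e k\<rangle>)"
proof -
  have *: "p = \<langle>x, y\<rangle> \<longleftrightarrow>
     (\<exists>a. a \<epsilon> p \<and> (\<exists>b. b \<epsilon> p \<and> (a = upair x x \<and> b = upair x y \<and> p = upair a b)))" for p x y
    unfolding kpair_def by auto
  show ?thesis unfolding *
    by (intro delta0_conj delta0_ex_mem delta0_eq_upair)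
qed

lemma delta0_kpair_mem: "delta0 (\<lambda>e. \<langle>e j, e k\<rangle> \<epsilon> e i)"
proof -
  have *: "\<langle>x, y\<rangle> \<epsilon> f \<longleftrightarrow> (\<exists>p. p \<epsilon> f \<and> p = \<langle>x, y\<rangle>)" for f x y
    by auto
  show ?thesis unfolding * by (intro delta0_ex_mem delta0_eq_kpair)
qed

lemma delta0_ex_components:
  assumes "delta0 (\<lambda>e. R (e (Suc 0)) (e 0) (\<lambda>n. e (Suc (Suc n))))"
  shows "delta0 (\<lambda>e. \<exists>x y. e i = \<langle>x, y\<rangle> \<and> R x y e)"
proof -
  have *: "(\<exists>x y. p = \<langle>x, y\<rangle> \<and> R x y e) \<longleftrightarrow>
     (\<exists>u. u \<epsilon> p \<and> (\<exists>x. x \<epsilon> u \<and> (\<exists>v. v \<epsilon> p \<and> (\<exists>y. y \<epsilon> v \<and> (p = \<langle>x, y\<rangle> \<and> R x y e)))))"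
    for p e
  proof
    assume "\<exists>x y. p = \<langle>x, y\<rangle> \<and> R x y e"
    then obtain x y where xy: "p = \<langle>x, y\<rangle>" "R x y e" by blast
    have "upair x x \<epsilon> \<langle>x, y\<rangle>" "upair x y \<epsilon> \<langle>x, y\<rangle>" "x \<epsilon> upair x x" "y \<epsilon> upair x y"
      unfolding kpair_def by simp_all
    with xy show "\<exists>u. u \<epsilon> p \<and> (\<exists>x. x \<epsilon> u \<and>
        (\<exists>v. v \<epsilon> p \<and> (\<exists>y. y \<epsilon> v \<and> (p = \<langle>x, y\<rangle> \<and> R x y e))))" by blast
  qed blast
  have "delta0 (\<lambda>e. R (e (Suc (Suc 0))) (e 0) (\<lambda>n. e (Suc (Suc (Suc (Suc n))))))"
    using delta0_rename[OF assms, of "case_nat 0 (case_nat 2 (\<lambda>n. Suc (Suc (Suc (Suc n)))))"]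
    by (simp add: numeral_2_eq_2)
  then show ?thesis unfolding *
    by (intro delta0_conj delta0_ex_mem delta0_eq_kpair)
qed

lemma delta0_all_components:
  assumes "delta0 (\<lambda>e. R (e (Suc 0)) (e 0) (\<lambda>n. e (Suc (Suc n))))"
  shows "delta0 (\<lambda>e. \<forall>x y. e i = \<langle>x, y\<rangle> \<longrightarrow> R x y e)"
proof -
  have "delta0 (\<lambda>e. \<not> (\<exists>x y. e i = \<langle>x, y\<rangle> \<and> \<not> R x y e))"
    by (intro delta0_not delta0_ex_components assms)
  then show ?thesis by simp
qed

lemma delta0_ex_kpair:
  assumes "delta0 (\<lambda>e. R (e (Suc 0)) (e 0) (\<lambda>n. e (Suc (Suc n))))"
  shows "delta0 (\<lambda>e. \<exists>x y. \<langle>x, y\<rangle> \<epsilon> e i \<and> R x y e)"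
proof -
  have *: "(\<exists>x y. \<langle>x, y\<rangle> \<epsilon> f \<and> R x y e) \<longleftrightarrow> (\<exists>p. p \<epsilon> f \<and> (\<exists>x y. p = \<langle>x, y\<rangle> \<and> R x y e))" for f e
    by blast
  have "delta0 (\<lambda>e. R (e (Suc 0)) (e 0) (\<lambda>n. e (Suc (Suc (Suc n)))))"
    using delta0_rename[OF assms, of "case_nat 0 (case_nat 1 (\<lambda>n. Suc (Suc (Suc n))))"] by simp
  then show ?thesis unfolding * by (intro delta0_ex_mem delta0_ex_components)
qed

lemma delta0_all_kpair:
  assumes "delta0 (\<lambda>e. R (e (Suc 0)) (e 0) (\<lambda>n. e (Suc (Suc n))))"
  shows "delta0 (\<lambda>e. \<forall>x y. \<langle>x, y\<rangle> \<epsilon> e i \<longrightarrow> R x y e)"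
proof -
  have "delta0 (\<lambda>e. \<not> (\<exists>x y. \<langle>x, y\<rangle> \<epsilon> e i \<and> \<not> R x y e))"
    by (intro delta0_not delta0_ex_kpair assms)
  then show ?thesis by simp
qed

lemma delta0_ex_value:
  assumes "delta0 (\<lambda>e. R (e 0) (\<lambda>n. e (Suc n)))"
  shows "delta0 (\<lambda>e. \<exists>x. \<langle>e j, x\<rangle> \<epsilon> e i \<and> R x e)"
proof -
  have *: "(\<exists>x. \<langle>c, x\<rangle> \<epsilon> f \<and> R x e) \<longleftrightarrow> (\<exists>c' x. \<langle>c', x\<rangle> \<epsilon> f \<and> (c' = c \<and> R x e))" for c f e
    by blast
  have "delta0 (\<lambda>e. R (e 0) (\<lambda>n. e (Suc (Suc n))))"
    using delta0_rename[OF assms, of "case_nat 0 (\<lambda>n. Suc (Suc n))"] by simp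
  then show ?thesis unfolding *
    by (intro delta0_ex_kpair delta0_conj delta0_eq)
qed

lemma delta0_all_value:
  assumes "delta0 (\<lambda>e. R (e 0) (\<lambda>n. e (Suc n)))"
  shows "delta0 (\<lambda>e. \<forall>x. \<langle>e j, x\<rangle> \<epsilon> e i \<longrightarrow> R x e)"
proof -
  have "delta0 (\<lambda>e. \<not> (\<exists>x. \<langle>e j, x\<rangle> \<epsilon> e i \<and> \<not> R x e))"
    by (intro delta0_not delta0_ex_value assms)
  then show ?thesis by simp
qed

lemma delta0_has_value: "delta0 (\<lambda>e. \<exists>x. \<langle>e j, x\<rangle> \<epsilon> e i)"
  using delta0_ex_value[of "\<lambda>x e. x = x" j i, OF delta0_eq] by simp

lemma delta0_nonempty: "delta0 (\<lambda>e. \<exists>x. x \<epsilon> e i)"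
  using delta0_ex_mem[of "\<lambda>x e. x = x" i, OF delta0_eq] by simp

lemma delta0_iff: "delta0 R \<Longrightarrow> delta0 S \<Longrightarrow> delta0 (\<lambda>e. R e \<longleftrightarrow> S e)"
  unfolding iff_conv_conj_imp by (intro delta0_conj delta0_imp)

lemma delta0_if:
  assumes "delta0 R" "delta0 S" "delta0 T"
  shows "delta0 (\<lambda>e. if R e then S e else T e)"
  unfolding if_bool_eq_conj by (intro delta0_conj delta0_imp delta0_not assms)

lemmas delta0_intros = delta0_mem delta0_eq delta0_subs delta0_eq_kpair delta0_kpair_mem
  delta0_conj delta0_disj delta0_imp delta0_not delta0_ex_mem delta0_all_mem delta0_all_subs
  delta0_ex_kpair delta0_all_kpair

end

section \<open>Recursion along membership\<close>

text \<open>The recursion \<open>F x = s \<union> {t. \<exists>z \<in> x. Q t (F z)}\<close> is shared by the cumulative hierarchy, where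
  \<open>Q\<close> is inclusion, and the rank function, where \<open>Q t w\<close> is \<open>t \<in> w \<union> {w}\<close>. The second assumption
  makes quantification over \<open>{t. Q t w}\<close> bounded; the third one provides the set required by
  separation.\<close>

locale mem_recursion = kpp +
  fixes Q :: "'a \<Rightarrow> 'a \<Rightarrow> bool"
  assumes delta0_Q: "delta0 (\<lambda>e. Q (e i) (e j))"
    and delta0_all_Q: "\<And>i R. delta0 (\<lambda>e. R (e 0) (\<lambda>n. e (Suc n))) \<Longrightarrow> delta0 (\<lambda>e. \<forall>t. Q t (e i) \<longrightarrow> R t e)"
    and Q_bounded: "\<exists>B. \<forall>w t. w \<epsilon> X \<longrightarrow> Q t w \<longrightarrow> t \<epsilon> B"
begin

text \<open>An approximation to the recursion with a domain closed under elements. The pairs in \<open>f\<close> are not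
  assumed to form a function: that the values are unique follows by induction from the recursion
  equation. So attempts are closed under unions. The equation is split into implications in which all
  quantifiers are bounded.\<close>

definition attempt :: "'a \<Rightarrow> 'a \<Rightarrow> bool" where
  "attempt s f \<longleftrightarrow> (\<forall>x y. \<langle>x, y\<rangle> \<epsilon> f \<longrightarrow> 
     (\<forall>z. z \<epsilon> x \<longrightarrow> (\<exists>z' w. \<langle>z', w\<rangle> \<epsilon> f \<and> z' = z)) \<and>
     (\<forall>t. t \<epsilon> y \<longrightarrow> t \<epsilon> s \<or> (\<exists>z w. \<langle>z, w\<rangle> \<epsilon> f \<and> z \<epsilon> x \<and> Q t w)) \<and>
     (\<forall>t. t \<epsilon> s \<longrightarrow> t \<epsilon> y) \<and> 
     (\<forall>z w. \<langle>z, w\<rangle> \<epsilon> f \<longrightarrow> z \<epsilon> x \<longrightarrow> (\<forall>t. Q t w \<longrightarrow> t \<epsilon> y)))"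

lemma delta0_attempt: "delta0 (\<lambda>e. attempt (e i) (e j))"
  unfolding attempt_def by (intro delta0_intros delta0_Q delta0_all_Q)

lemma attempt_dom: "attempt s f \<Longrightarrow> \<langle>x, y\<rangle> \<epsilon> f \<Longrightarrow> z \<epsilon> x \<Longrightarrow> \<exists>w. \<langle>z, w\<rangle> \<epsilon> f"
  unfolding attempt_def by blast

lemma attempt_eq: "attempt s f \<Longrightarrow> \<langle>x, y\<rangle> \<epsilon> f \<Longrightarrow>
  t \<epsilon> y \<longleftrightarrow> t \<epsilon> s \<or> (\<exists>z w. \<langle>z, w\<rangle> \<epsilon> f \<and> z \<epsilon> x \<and> Q t w)"
  unfolding attempt_def by blast

lemma attemptI:
  assumes "\<And>x y z. \<langle>x, y\<rangle> \<epsilon> f \<Longrightarrow> z \<epsilon> x \<Longrightarrow> \<exists>w. \<langle>z, w\<rangle> \<epsilon> f"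
    and "\<And>x y t. \<langle>x, y\<rangle> \<epsilon> f \<Longrightarrow> t \<epsilon> y \<longleftrightarrow> t \<epsilon> s \<or> (\<exists>z w. \<langle>z, w\<rangle> \<epsilon> f \<and> z \<epsilon> x \<and> Q t w)"
  shows "attempt s f"
  unfolding attempt_def using assms by blast

lemma attempt_unique:
  assumes f: "attempt s f" and g: "attempt s g"
  shows "\<langle>x, y\<rangle> \<epsilon> f \<Longrightarrow> \<langle>x, y'\<rangle> \<epsilon> g \<Longrightarrow> y = y'"
proof -
  let ?R = "\<lambda>e. \<forall>x y. \<langle>x, y\<rangle> \<epsilon> e (Suc 0) \<longrightarrow> x = e 0 \<longrightarrow>
     (\<forall>x' y'. \<langle>x', y'\<rangle> \<epsilon> e (Suc (Suc 0)) \<longrightarrow> x' = e 0 \<longrightarrow> y = y')"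
  have "?R ((!) [x, f, g])"
  proof (rule sigma1_induct)
    show "sigma1 ?R" by (intro sigma1_delta0 delta0_intros)
  next
    fix x assume IH: "\<And>z. z \<epsilon> x \<Longrightarrow> ?R ((!) [z, f, g])"
    have "y = y'" if xy: "\<langle>x, y\<rangle> \<epsilon> f" "\<langle>x, y'\<rangle> \<epsilon> g" for y y'
    proof (rule ext)
      have *: "w = w'" if "z \<epsilon> x" "\<langle>z, w\<rangle> \<epsilon> f" "\<langle>z, w'\<rangle> \<epsilon> g" for z w w'
        using IH that by simp
      have "\<langle>z, w\<rangle> \<epsilon> f \<longleftrightarrow> \<langle>z, w\<rangle> \<epsilon> g" if z: "z \<epsilon> x" for z w
      proof -
        obtain v v' where v: "\<langle>z, v\<rangle> \<epsilon> f" "\<langle>z, v'\<rangle> \<epsilon> g"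
          using attempt_dom[OF f xy(1) z] attempt_dom[OF g xy(2) z] by blast
        then show ?thesis using *[OF z] by metis
      qed
      then show "t \<epsilon> y \<longleftrightarrow> t \<epsilon> y'" for t
        unfolding attempt_eq[OF f xy(1)] attempt_eq[OF g xy(2)] by blast
    qed
    then show "?R ((!) [x, f, g])" by simp
  qed
  then show "\<langle>x, y\<rangle> \<epsilon> f \<Longrightarrow> \<langle>x, y'\<rangle> \<epsilon> g \<Longrightarrow> y = y'" by simp
qed

lemma attempt_bigunion:
  assumes "\<And>f. f \<epsilon> F \<Longrightarrow> attempt s f"
  shows "attempt s (bigunion F)"
proof (rule attemptI)
  fix x y z assume "\<langle>x, y\<rangle> \<epsilon> bigunion F" "z \<epsilon> x"
  then show "\<exists>w. \<langle>z, w\<rangle> \<epsilon> bigunion F" using attempt_dom assms by simp blast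
next
  fix x y t assume "\<langle>x, y\<rangle> \<epsilon> bigunion F"
  then obtain f where f: "f \<epsilon> F" "\<langle>x, y\<rangle> \<epsilon> f" by auto
  have *: "\<langle>z, w\<rangle> \<epsilon> f" if "\<langle>z, w\<rangle> \<epsilon> bigunion F" "z \<epsilon> x" for z w
  proof -
    from attempt_dom[OF assms[OF f(1)] f(2) that(2)] obtain w' where "\<langle>z, w'\<rangle> \<epsilon> f" by blast
    moreover from that(1) obtain g where "g \<epsilon> F" "\<langle>z, w\<rangle> \<epsilon> g" by auto
    ultimately show ?thesis using attempt_unique[OF assms assms] f(1) by metis
  qed
  moreover have "\<langle>z, w\<rangle> \<epsilon> bigunion F" if "\<langle>z, w\<rangle> \<epsilon> f" for z w
    using that f by auto
  ultimately show "t \<epsilon> y \<longleftrightarrow> t \<epsilon> s \<or> (\<exists>z w. \<langle>z, w\<rangle> \<epsilon> bigunion F \<and> z \<epsilon> x \<and> Q t w)"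
    unfolding attempt_eq[OF assms[OF f(1)] f(2)] by blast
qed

text \<open>If \<open>x\<close> has no value yet, one new pair suffices. It does not disturb the old equations, because
  the elements of arguments of \<open>f\<close> are arguments of \<open>f\<close> and hence different from \<open>x\<close>.\<close>

lemma attempt_extend:
  assumes f: "attempt s f" and dom: "\<And>z. z \<epsilon> x \<Longrightarrow> \<exists>w. \<langle>z, w\<rangle> \<epsilon> f"
  shows "\<exists>g. attempt s g \<and> (\<exists>y. \<langle>x, y\<rangle> \<epsilon> g)"
proof (cases "\<exists>y. \<langle>x, y\<rangle> \<epsilon> f")
  case False
  from Q_bounded[of "bigunion (bigunion f)"] obtain B
    where B: "\<And>w t. w \<epsilon> bigunion (bigunion f) \<Longrightarrow> Q t w \<Longrightarrow> t \<epsilon> B" by blast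
  let ?S = "\<lambda>e. e 0 \<epsilon> e 1 \<or> (\<exists>z w. \<langle>z, w\<rangle> \<epsilon> e 2 \<and> z \<epsilon> e 3 \<and> Q (e 0) w)"
  have "delta0 ?S" by (intro delta0_intros delta0_Q)
  from separation0[OF this, of "union s B" "[s, f, x]"] obtain y
    where "\<And>t. t \<epsilon> y \<longleftrightarrow> t \<epsilon> union s B \<and> (t \<epsilon> s \<or> (\<exists>z w. \<langle>z, w\<rangle> \<epsilon> f \<and> z \<epsilon> x \<and> Q t w))"
    by auto
  then have y: "t \<epsilon> y \<longleftrightarrow> t \<epsilon> s \<or> (\<exists>z w. \<langle>z, w\<rangle> \<epsilon> f \<and> z \<epsilon> x \<and> Q t w)" for t
    unfolding mem_union using B[OF kpair_mem_field(2)] by blast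
  define g where "g = union f (upair \<langle>x, y\<rangle> \<langle>x, y\<rangle>)"
  have g: "\<langle>a, b\<rangle> \<epsilon> g \<longleftrightarrow> \<langle>a, b\<rangle> \<epsilon> f \<or> a = x \<and> b = y" for a b
    unfolding g_def by simp
  have restrict: "\<langle>a, b\<rangle> \<epsilon> g \<longleftrightarrow> \<langle>a, b\<rangle> \<epsilon> f" if "\<langle>c, d\<rangle> \<epsilon> g" "a \<epsilon> c" for a b c d
  proof -
    have "a \<noteq> x"
    proof (cases "\<langle>c, d\<rangle> \<epsilon> f")
      case True
      then show ?thesis using attempt_dom[OF f True that(2)] False by blast
    next
      case False
      then show ?thesis using that g by auto
    qed
    then show ?thesis using g by blast
  qed
  have "attempt s g"
  proof (rule attemptI)
    fix a b c assume "\<langle>a, b\<rangle> \<epsilon> g" "c \<epsilon> a"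
    then show "\<exists>w. \<langle>c, w\<rangle> \<epsilon> g" using g attempt_dom[OF f] dom by blast
  next
    fix a b t assume ab: "\<langle>a, b\<rangle> \<epsilon> g"
    have "t \<epsilon> b \<longleftrightarrow> t \<epsilon> s \<or> (\<exists>z w. \<langle>z, w\<rangle> \<epsilon> f \<and> z \<epsilon> a \<and> Q t w)"
      using ab y attempt_eq[OF f] unfolding g by blast
    with restrict[OF ab] show "t \<epsilon> b \<longleftrightarrow> t \<epsilon> s \<or> (\<exists>z w. \<langle>z, w\<rangle> \<epsilon> g \<and> z \<epsilon> a \<and> Q t w)"
      by blast
  qed
  then show ?thesis using g by blast
qed (use f in blast)

text \<open>By induction on \<open>x\<close>: collection gives a set of attempts defined at the elements of \<open>x\<close>, whose
  union extends to \<open>x\<close>.\<close>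

lemma attempt_exists: "\<exists>f. attempt s f \<and> (\<exists>y. \<langle>x, y\<rangle> \<epsilon> f)"
proof -
  let ?T = "\<lambda>e. attempt (e (Suc (Suc 0))) (e (Suc 0)) \<and> (\<exists>x' y. \<langle>x', y\<rangle> \<epsilon> e (Suc 0) \<and> x' = e 0)"
  let ?R = "\<lambda>e. \<exists>f. attempt (e (Suc 0)) f \<and> (\<exists>x' y. \<langle>x', y\<rangle> \<epsilon> f \<and> x' = e 0)"
  have "?R ((!) [x, s])"
  proof (rule sigma1_induct)
    show "sigma1 ?R" by (intro sigma1_ex_delta0 delta0_intros delta0_attempt)
  next
    fix x assume IH: "\<And>z. z \<epsilon> x \<Longrightarrow> ?R ((!) [z, s])"
    have T: "delta0 ?T" by (intro delta0_intros delta0_attempt)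
    have "\<exists>G. \<forall>z. z \<epsilon> x \<longrightarrow> (\<exists>f. f \<epsilon> G \<and> ?T ((!) [z, f, s]))"
      by (rule collection0[OF T]) (use IH in simp)
    then obtain G where G: "\<And>z. z \<epsilon> x \<Longrightarrow> \<exists>f. f \<epsilon> G \<and> attempt s f \<and> (\<exists>y. \<langle>z, y\<rangle> \<epsilon> f)" by auto
    have "delta0 (\<lambda>e. attempt (e 1) (e 0))" by (rule delta0_attempt)
    from separation0[OF this, of G "[s]"] obtain F where F: "\<And>f. f \<epsilon> F \<longleftrightarrow> f \<epsilon> G \<and> attempt s f"
      by auto
    have "attempt s (bigunion F)" using F by (blast intro: attempt_bigunion)
    moreover have "\<exists>w. \<langle>z, w\<rangle> \<epsilon> bigunion F" if "z \<epsilon> x" for z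
      unfolding mem_bigunion F using G[OF that] by blast
    ultimately have "\<exists>g. attempt s g \<and> (\<exists>y. \<langle>x, y\<rangle> \<epsilon> g)" by (rule attempt_extend)
    then show "?R ((!) [x, s])" by simp
  qed
  then show ?thesis by simp
qed

definition rec :: "'a \<Rightarrow> 'a \<Rightarrow> 'a" where
  "rec s x = (THE y. \<exists>f. attempt s f \<and> \<langle>x, y\<rangle> \<epsilon> f)"

lemma rec_eq_iff: "rec s x = y \<longleftrightarrow> (\<exists>f. attempt s f \<and> \<langle>x, y\<rangle> \<epsilon> f)"
proof -
  obtain f y\<^sub>0 where f: "attempt s f" "\<langle>x, y\<^sub>0\<rangle> \<epsilon> f" using attempt_exists by blast
  have unique: "y = y\<^sub>0" if "\<exists>g. attempt s g \<and> \<langle>x, y\<rangle> \<epsilon> g" for y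
    using that attempt_unique[OF _ f(1) _ f(2)] by blast
  have "rec s x = y\<^sub>0" unfolding rec_def using f unique by (intro the_equality) blast+
  then show ?thesis using f unique by blast
qed

lemma rec_attempt: "\<exists>f. attempt s f \<and> \<langle>x, rec s x\<rangle> \<epsilon> f"
  using rec_eq_iff[of s x "rec s x"] by (rule iffD1) (rule refl)

lemma mem_rec: "t \<epsilon> rec s x \<longleftrightarrow> t \<epsilon> s \<or> (\<exists>z. z \<epsilon> x \<and> Q t (rec s z))"
proof -
  obtain f where f: "attempt s f" "\<langle>x, rec s x\<rangle> \<epsilon> f"
    using rec_attempt[of s x] by (elim exE conjE)
  have "\<langle>z, w\<rangle> \<epsilon> f \<longleftrightarrow> w = rec s z" if z: "z \<epsilon> x" for z w
  proof -
    from attempt_dom[OF f z] obtain w' where w': "\<langle>z, w'\<rangle> \<epsilon> f" by blast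
    then have "rec s z = w'" unfolding rec_eq_iff using f(1) by blast
    then show ?thesis using w' attempt_unique[OF f(1) f(1)] by blast
  qed
  then show ?thesis unfolding attempt_eq[OF f] by metis
qed

lemma sigma1_rec: "sigma1 (\<lambda>e. rec (e i) (e j) = e k)"
  unfolding rec_eq_iff by (intro sigma1_ex_delta0 delta0_intros delta0_attempt)

end

section \<open>The cumulative hierarchy and ranks\<close>

sublocale kpp \<subseteq> cumul: mem_recursion E "(\<sqsubseteq>)"
proof (unfold_locales, goal_cases)
  case 1 show ?case by (rule delta0_subs)
next
  case 2 then show ?case by (rule delta0_all_subs)
next
  case (3 X)
  have "t \<epsilon> pow (bigunion X)" if "w \<epsilon> X" "t \<sqsubseteq> w" for w t
    using that by (auto simp: subs_def)
  then show ?case by blast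
qed

sublocale kpp \<subseteq> rk: mem_recursion E "\<lambda>t w. t \<epsilon> w \<or> t = w"
proof (unfold_locales, goal_cases)
  case 1 show ?case by (intro delta0_intros)
next
  case (2 i R)
  have "(\<forall>t. t \<epsilon> x \<or> t = x \<longrightarrow> R t e) \<longleftrightarrow> (\<forall>t. t \<epsilon> x \<longrightarrow> R t e) \<and> R x e" for x e by auto
  with 2 show ?case by (simp add: delta0_conj delta0_all_mem delta0_subst)
next
  case (3 X)
  have "t \<epsilon> union X (bigunion X)" if "w \<epsilon> X" "t \<epsilon> w \<or> t = w" for w t
    using that by auto
  then show ?case by blast
qed

context kpp begin

definition transitive :: "'a \<Rightarrow> bool" where
  "transitive x \<longleftrightarrow> (\<forall>y. y \<epsilon> x \<longrightarrow> y \<sqsubseteq> x)"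

lemma transitiveD: "transitive x \<Longrightarrow> y \<epsilon> x \<Longrightarrow> z \<epsilon> y \<Longrightarrow> z \<epsilon> x"
  unfolding transitive_def subs_def by blast

lemma subsD: "x \<sqsubseteq> y \<Longrightarrow> z \<epsilon> x \<Longrightarrow> z \<epsilon> y"
  unfolding subs_def by blast

lemma delta0_transitive: "delta0 (\<lambda>e. transitive (e i))"
  unfolding transitive_def by (intro delta0_intros)

text \<open>The level at \<open>x\<close> of the cumulative hierarchy over \<open>s\<close>. It is indexed by arbitrary sets \<open>x\<close>; by
  \<open>hier_rnk\<close> below, the level over the empty set depends only on the rank of \<open>x\<close>.\<close>

definition hier :: "'a \<Rightarrow> 'a \<Rightarrow> 'a" where
  "hier s x = cumul.rec s x"

definition rnk :: "'a \<Rightarrow> 'a" where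
  "rnk x = rk.rec empty x"

lemma mem_hier: "t \<epsilon> hier s x \<longleftrightarrow> t \<epsilon> s \<or> (\<exists>z. z \<epsilon> x \<and> t \<sqsubseteq> hier s z)"
  unfolding hier_def by (rule cumul.mem_rec)

lemma mem_rnk: "t \<epsilon> rnk x \<longleftrightarrow> (\<exists>z. z \<epsilon> x \<and> (t \<epsilon> rnk z \<or> t = rnk z))"
  unfolding rnk_def by (subst rk.mem_rec) simp

lemma sigma1_hier: "sigma1 (\<lambda>e. hier (e i) (e j) = e k)"
  unfolding hier_def by (rule cumul.sigma1_rec)

text \<open>Here the starting set of the recursion is not a parameter of the predicate, so the empty set is
  quantified and then characterized.\<close>

lemma sigma1_rnk: "sigma1 (\<lambda>e. rnk (e i) = e j)"
proof -
  have *: "sigma1 (\<lambda>e. \<exists>s. (\<forall>x. x \<epsilon> s \<longrightarrow> \<not> s = s) \<and> rk.rec s (e i) = e j)"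
    by (intro sigma1_ex sigma1_conj sigma1_delta0 delta0_intros rk.sigma1_rec)
  have "(\<exists>s. (\<forall>x. x \<epsilon> s \<longrightarrow> \<not> s = s) \<and> rk.rec s y = z) \<longleftrightarrow> rnk y = z" for y z
  proof -
    have "(\<forall>x. x \<epsilon> s \<longrightarrow> \<not> s = s) \<longleftrightarrow> s = empty" for s by (auto intro: ext)
    then show ?thesis unfolding rnk_def by simp
  qed
  with * show ?thesis by simp
qed

lemma mem_hierI: "z \<epsilon> x \<Longrightarrow> t \<sqsubseteq> hier s z \<Longrightarrow> t \<epsilon> hier s x"
  using mem_hier[of t s x] by blast

lemma hier_base: "s \<sqsubseteq> hier s x"
  unfolding subs_def using mem_hier[of _ s x] by blast

lemma transitive_hier:
  assumes "transitive s"
  shows "transitive (hier s x)"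
proof -
  let ?R = "\<lambda>e. \<exists>v. hier (e (Suc 0)) (e 0) = v \<and> transitive v"
  have "?R ((!) [x, s])"
  proof (rule sigma1_induct)
    show "sigma1 ?R"
      by (intro sigma1_ex sigma1_conj sigma1_hier sigma1_delta0 delta0_transitive)
  next
    fix x assume IH: "\<And>z. z \<epsilon> x \<Longrightarrow> ?R ((!) [z, s])"
    have "u \<epsilon> hier s x" if t: "t \<epsilon> hier s x" and u: "u \<epsilon> t" for t u
    proof (cases "t \<epsilon> s")
      case True
      then show ?thesis using transitiveD[OF assms True u] subsD[OF hier_base] by blast
    next
      case False
      then obtain z where z: "z \<epsilon> x" "t \<sqsubseteq> hier s z" using t mem_hier[of t s x] by blast
      then have "u \<sqsubseteq> hier s z" using IH[OF z(1)] subsD[OF z(2) u] unfolding transitive_def by simp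
      then show ?thesis by (rule mem_hierI[OF z(1)])
    qed
    then show "?R ((!) [x, s])" by (simp add: transitive_def subs_def)
  qed
  then show ?thesis by simp
qed

lemma hier_mono: "transitive s \<Longrightarrow> z \<epsilon> x \<Longrightarrow> hier s z \<sqsubseteq> hier s x"
  unfolding subs_def using mem_hierI[of z x "hier s z" s] transitiveD[OF transitive_hier]
  by (metis subs_def)

lemma transitive_empty: "transitive empty"
  unfolding transitive_def by simp

lemma subs_hier: "x \<sqsubseteq> hier s x"
proof -
  let ?R = "\<lambda>e. \<exists>v. hier (e (Suc 0)) (e 0) = v \<and> e 0 \<sqsubseteq> v"
  have "?R ((!) [x, s])"
  proof (rule sigma1_induct)
    show "sigma1 ?R"
      by (intro sigma1_ex sigma1_conj sigma1_hier sigma1_delta0 delta0_subs)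
  next
    fix x assume IH: "\<And>z. z \<epsilon> x \<Longrightarrow> ?R ((!) [z, s])"
    have "z \<epsilon> hier s x" if "z \<epsilon> x" for z
      using mem_hierI[OF that] IH[OF that] by simp
    then show "?R ((!) [x, s])" by (simp add: subs_def)
  qed
  then show ?thesis by simp
qed

lemma hier_rnk: "hier empty (rnk x) = hier empty x"
proof -
  let ?R = "\<lambda>e. \<exists>r. rnk (e 0) = r \<and>
    (\<exists>v. hier (e (Suc 0)) (e 0) = v \<and> hier (e (Suc 0)) r = v)"
  have "?R ((!) [x, empty])"
  proof (rule sigma1_induct)
    show "sigma1 ?R"
      by (intro sigma1_ex sigma1_conj sigma1_hier sigma1_rnk)
  next
    fix x assume "\<And>z. z \<epsilon> x \<Longrightarrow> ?R ((!) [z, empty])"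
    then have IH: "\<And>z. z \<epsilon> x \<Longrightarrow> hier empty (rnk z) = hier empty z" by simp
    have "hier empty (rnk x) = hier empty x"
    proof (rule ext)
      fix t
      show "t \<epsilon> hier empty (rnk x) \<longleftrightarrow> t \<epsilon> hier empty x"
      proof
        assume "t \<epsilon> hier empty (rnk x)"
        then obtain a where a: "a \<epsilon> rnk x" "t \<sqsubseteq> hier empty a" 
          using mem_hier[of t empty "rnk x"] by auto
        then obtain z where z: "z \<epsilon> x" "a \<epsilon> rnk z \<or> a = rnk z" using mem_rnk[of a x] by blast
        have "hier empty a \<sqsubseteq> hier empty (rnk z)"
          using z(2) hier_mono[OF transitive_empty] by (auto simp: subs_def)
        with a have "t \<sqsubseteq> hier empty z" unfolding IH[OF z(1)] by (auto simp: subs_def)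
        then show "t \<epsilon> hier empty x" using z(1) by (rule mem_hierI[rotated])
      next
        assume "t \<epsilon> hier empty x"
        then obtain z where z: "z \<epsilon> x" "t \<sqsubseteq> hier empty z"
          using mem_hier[of t empty x] by auto
        moreover have "rnk z \<epsilon> rnk x" using z mem_rnk[of "rnk z" x] by blast
        ultimately show "t \<epsilon> hier empty (rnk x)" using IH[of z] mem_hierI[of "rnk z" "rnk x" t empty] by simp
      qed
    qed
    then show "?R ((!) [x, empty])" by simp
  qed
  then show ?thesis by simp
qed

lemma rnk_mem: "z \<epsilon> x \<Longrightarrow> rnk z \<epsilon> rnk x"
  using mem_rnk[of "rnk z" x] by blast

lemma rnk_subs: "z \<sqsubseteq> x \<Longrightarrow> rnk z \<sqsubseteq> rnk x"
  unfolding subs_def by (subst (1 2) mem_rnk) blast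

lemma rnk_mem_hier: "rnk x \<epsilon> a \<Longrightarrow> x \<epsilon> hier empty a"
  using mem_hierI[of "rnk x" a x empty] subs_hier[of x empty] by (simp add: hier_rnk)

text \<open>In \<open>Ord_in\<close> ordinals are linearly ordered by definition, which does not pass directly to suprema
  of ordinals. Hereditary transitivity does, and it implies linearity.\<close>

definition ord :: "'a \<Rightarrow> bool" where
  "ord a \<longleftrightarrow> transitive a \<and> (\<forall>b. b \<epsilon> a \<longrightarrow> transitive b)"

lemma delta0_ord: "delta0 (\<lambda>e. ord (e i))"
  unfolding ord_def by (intro delta0_intros delta0_transitive)

lemma ord_mem: "ord a \<Longrightarrow> b \<epsilon> a \<Longrightarrow> ord b"
  unfolding ord_def transitive_def subs_def by blast

lemma ord_rnk: "ord (rnk x)"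
proof -
  let ?R = "\<lambda>e. \<exists>v. rnk (e 0) = v \<and> ord v"
  have "?R ((!) [x])"
  proof (rule sigma1_induct)
    show "sigma1 ?R"
      by (intro sigma1_ex sigma1_conj sigma1_rnk sigma1_delta0 delta0_ord)
  next
    fix x assume "\<And>z. z \<epsilon> x \<Longrightarrow> ?R ((!) [z])"
    then have IH: "\<And>z. z \<epsilon> x \<Longrightarrow> ord (rnk z)" by simp
    have t: "transitive t" if "t \<epsilon> rnk x" for t
      using that IH mem_rnk[of t x] unfolding ord_def by blast
    have "u \<epsilon> rnk x" if t: "t \<epsilon> rnk x" and u: "u \<epsilon> t" for t u
    proof -
      obtain z where z: "z \<epsilon> x" "t \<epsilon> rnk z \<or> t = rnk z" using t mem_rnk[of t x] by blast
      then have "u \<epsilon> rnk z" using u IH[OF z(1)] transitiveD unfolding ord_def by blast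
      with z show ?thesis using mem_rnk[of u x] by blast
    qed
    with t have "ord (rnk x)" unfolding ord_def transitive_def[of "rnk x"] subs_def by blast
    then show "?R ((!) [x])" by simp
  qed
  then show ?thesis by simp
qed

text \<open>Induction on \<open>a\<close> for all \<open>b\<close> in a fixed transitive set \<open>B\<close>, with an inner induction on \<open>b\<close>. The
  restriction to \<open>B\<close> keeps the induction predicate bounded. If neither of \<open>a\<close> and \<open>b\<close> is an element
  of the other, then the comparisons with smaller ordinals show that they have the same elements.\<close>

lemma ord_linear:
  assumes "ord a" "ord b"
  shows "a \<epsilon> b \<or> a = b \<or> b \<epsilon> a"
proof -
  define B where "B = union b (upair b b)"
  have mem_B: "x \<epsilon> B \<longleftrightarrow> x \<epsilon> b \<or> x = b" for x unfolding B_def by simp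
  have trans_b: "transitive b" using assms(2) unfolding ord_def by blast
  have B: "transitive x" if "x \<epsilon> B" for x
    using that assms(2) unfolding mem_B ord_def by blast
  have trans_B: "t \<epsilon> B" if "t \<epsilon> x" "x \<epsilon> B" for t x
    using that transitiveD[OF trans_b, of x t] unfolding mem_B by blast
  let ?P = "\<lambda>e. ord (e 0) \<longrightarrow> (\<forall>b. b \<epsilon> e (Suc 0) \<longrightarrow> e 0 \<epsilon> b \<or> e 0 = b \<or> b \<epsilon> e 0)"
  have "?P ((!) [a, B])"
  proof (rule sigma1_induct)
    show "sigma1 ?P" by (intro sigma1_delta0 delta0_intros delta0_ord)
  next
    fix a assume IH: "\<And>x. x \<epsilon> a \<Longrightarrow> ?P ((!) [x, B])"
    let ?Q = "\<lambda>e. e 0 \<epsilon> e (Suc 0) \<longrightarrow> e 2 \<epsilon> e 0 \<or> e 2 = e 0 \<or> e 0 \<epsilon> e 2"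
    have "?Q ((!) [b, B, a])" if a: "ord a" for b
    proof (rule sigma1_induct)
      show "sigma1 ?Q" by (intro sigma1_delta0 delta0_intros)
    next
      fix b assume IHb: "\<And>x. x \<epsilon> b \<Longrightarrow> ?Q ((!) [x, B, a])"
      have "a = b" if b: "b \<epsilon> B" and nab: "\<not> a \<epsilon> b" "\<not> b \<epsilon> a"
      proof (rule ext)
        fix t
        have "t \<epsilon> a" if t: "t \<epsilon> b"
        proof -
          have "t \<epsilon> B" using t b by (rule trans_B)
          with IHb[OF t] have "a \<epsilon> t \<or> a = t \<or> t \<epsilon> a" by simp
          then show ?thesis using t nab transitiveD[OF B[OF b] t, of a] by blast
        qed
        moreover have "t \<epsilon> b" if t: "t \<epsilon> a"
        proof -
          from IH[OF t] ord_mem[OF a t] b have "t \<epsilon> b \<or> t = b \<or> b \<epsilon> t" by simp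
          moreover have "transitive a" using a unfolding ord_def by blast
          ultimately show ?thesis using t nab transitiveD[of a t b] by blast
        qed
        ultimately show "t \<epsilon> a \<longleftrightarrow> t \<epsilon> b" by blast
      qed
      then show "?Q ((!) [b, B, a])" by auto
    qed
    then show "?P ((!) [a, B])" by simp
  qed
  with assms show ?thesis by (simp add: mem_B)
qed

lemma rnk_in_Ord_in: "rnk x \<in> Ord_in UNIV E"
proof -
  have o: "ord (rnk x)" by (rule ord_rnk)
  have "y \<epsilon> z \<or> y = z \<or> z \<epsilon> y" if "y \<epsilon> rnk x" "z \<epsilon> rnk x" for y z
    using that ord_mem[OF o] ord_linear by blast
  with o show ?thesis
    unfolding Ord_in_def transitive_in_def ord_def transitive_def subs_def by blast
qed

text \<open>Together with its converse below, this identifies \<open>rank\<close> with the function defined by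
  recursion.\<close>

lemma rank_function_attempt:
  assumes "rank_function UNIV E f d"
  shows "rk.attempt empty f"
proof (rule rk.attemptI)
  have tr: "transitive_in UNIV E d" and fn: "function_on UNIV E f d"
    and rec: "\<forall>x y. x \<epsilon> d \<longrightarrow> \<langle>x, y\<rangle> \<epsilon> f \<longrightarrow>
      (\<forall>t. t \<epsilon> y \<longleftrightarrow> (\<exists>z w. z \<epsilon> x \<and> \<langle>z, w\<rangle> \<epsilon> f \<and> (t \<epsilon> w \<or> t = w)))"
    using assms unfolding rank_function_def maps_to_iff ball_UNIV bex_UNIV by - (elim conjE, assumption)+
  have dom: "x \<epsilon> d" if "\<langle>x, y\<rangle> \<epsilon> f" for x y
  proof -
    have "\<exists>a b. a \<epsilon> d \<and> \<langle>x, y\<rangle> = \<langle>a, b\<rangle>"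
      using fn that unfolding function_on_def is_opair_iff by blast
    then show ?thesis by simp
  qed
  have tot: "\<exists>y. \<langle>x, y\<rangle> \<epsilon> f" if "x \<epsilon> d" for x
    using fn that unfolding function_on_def maps_to_iff by blast
  fix x y assume xy: "\<langle>x, y\<rangle> \<epsilon> f"
  show "\<exists>w. \<langle>z, w\<rangle> \<epsilon> f" if z: "z \<epsilon> x" for z
  proof (rule tot)
    show "z \<epsilon> d" using tr z dom[OF xy] unfolding transitive_in_def by blast
  qed
  show "t \<epsilon> y \<longleftrightarrow> t \<epsilon> empty \<or> (\<exists>z w. \<langle>z, w\<rangle> \<epsilon> f \<and> z \<epsilon> x \<and> (t \<epsilon> w \<or> t = w))" for t
    unfolding rec[rule_format, OF dom[OF xy] xy, of t] using mem_empty[of t] by blast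
qed

lemma attempt_rank_function:
  assumes f: "rk.attempt empty f" and xy: "\<langle>x, y\<rangle> \<epsilon> f"
  shows "has_rank UNIV E x y"
proof -
  have "delta0 (\<lambda>e. \<exists>x y. \<langle>x, y\<rangle> \<epsilon> e 1 \<and> e 0 = \<langle>x, y\<rangle>)" by (intro delta0_intros)
  from separation0[OF this, of f "[f]"] obtain g
    where g': "\<And>p. p \<epsilon> g \<longleftrightarrow> p \<epsilon> f \<and> (\<exists>x y. \<langle>x, y\<rangle> \<epsilon> f \<and> p = \<langle>x, y\<rangle>)" by auto
  then have g: "\<langle>x, y\<rangle> \<epsilon> g \<longleftrightarrow> \<langle>x, y\<rangle> \<epsilon> f" for x y by auto
  have "delta0 (\<lambda>e. \<exists>x y. \<langle>x, y\<rangle> \<epsilon> e 1 \<and> e 0 = x)" by (intro delta0_intros)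
  from separation0[OF this, of "bigunion (bigunion f)" "[f]"] obtain d
    where d': "\<And>x. x \<epsilon> d \<longleftrightarrow> x \<epsilon> bigunion (bigunion f) \<and> (\<exists>y. \<langle>x, y\<rangle> \<epsilon> f)" by auto
  have d: "x \<epsilon> d \<longleftrightarrow> (\<exists>y. \<langle>x, y\<rangle> \<epsilon> f)" for x
    unfolding d' using kpair_mem_field(1) by blast
  have "rank_function UNIV E g d"
    unfolding rank_function_def
  proof (intro conjI)
    show "transitive_in UNIV E d"
      unfolding transitive_in_def d using rk.attempt_dom[OF f] by blast
    show "function_on UNIV E g d"
      unfolding function_on_def using rk.attempt_unique[OF f f] g' d g by simp blast
    show "\<forall>x\<in>UNIV. \<forall>y\<in>UNIV. x \<epsilon> d \<longrightarrow> maps_to UNIV (\<epsilon>) g x y \<longrightarrow>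
        (\<forall>t\<in>UNIV. t \<epsilon> y \<longleftrightarrow> (\<exists>z\<in>UNIV. \<exists>w\<in>UNIV. z \<epsilon> x \<and> maps_to UNIV (\<epsilon>) g z w \<and> (t \<epsilon> w \<or> t = w)))"
      using rk.attempt_eq[OF f] by (auto simp: g)
  qed
  moreover have "x \<epsilon> d" "\<langle>x, y\<rangle> \<epsilon> g" using xy unfolding d g by blast+
  ultimately show ?thesis unfolding has_rank_def by auto
qed

lemma has_rank_iff: "has_rank UNIV E x y \<longleftrightarrow> y = rnk x"
proof
  assume "has_rank UNIV E x y"
  then show "y = rnk x"
    unfolding has_rank_def using rank_function_attempt rk.rec_eq_iff[of empty x y] by (auto simp: rnk_def)
next
  assume "y = rnk x"
  then show "has_rank UNIV E x y"
    using attempt_rank_function rk.rec_attempt[of empty x] unfolding rnk_def by blast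
qed

lemma rank_eq: "rank UNIV E x = rnk x"
  unfolding rank_def has_rank_iff by simp

end

section \<open>Separation from embeddings\<close>

text \<open>Witnesses for a bounded quantifier are elements or subsets of a point in the range of \<open>i\<close>, hence
  again in the range.\<close>

lemma Delta0P_elementary:
  fixes E :: "'a \<Rightarrow> 'a \<Rightarrow> bool"
  assumes i: "\<And>x y. E x y \<longleftrightarrow> E (i x) (i y)" "inj i"
    and mem: "\<And>x z. E z (i x) \<Longrightarrow> z \<in> range i"
    and sub: "\<And>x z. (\<And>t. E t z \<Longrightarrow> E t (i x)) \<Longrightarrow> z \<in> range i"
  shows "p \<in> Delta0P \<Longrightarrow> sat UNIV E e p \<longleftrightarrow> sat UNIV E (\<lambda>n. i (e n)) p"
proof (induction p arbitrary: e rule: Delta0P.induct)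
  have case_nat_i: "(\<lambda>n. i (case_nat x e n)) = case_nat (i x) (\<lambda>n. i (e n))" for x e
    by (auto simp: fun_eq_iff split: nat.split)
  have members: "(\<forall>z. E z (i x) \<longrightarrow> P z) \<longleftrightarrow> (\<forall>z. E z x \<longrightarrow> P (i z))" for P x
    using mem i(1) by blast
  have subsets: "(\<forall>z. (\<forall>t. E t z \<longrightarrow> E t (i x)) \<longrightarrow> P z) \<longleftrightarrow>
      (\<forall>z. (\<forall>t. E t z \<longrightarrow> E t x) \<longrightarrow> P (i z))" for P x
  proof safe
    fix z assume *: "\<forall>z. (\<forall>t. E t z \<longrightarrow> E t (i x)) \<longrightarrow> P z" and "\<forall>t. E t z \<longrightarrow> E t x"
    then have "\<forall>t. E t (i z) \<longrightarrow> E t (i x)" unfolding members using i(1) by blast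
    with * show "P (i z)" by blast
  next
    fix z assume *: "\<forall>z. (\<forall>t. E t z \<longrightarrow> E t x) \<longrightarrow> P (i z)" and z: "\<forall>t. E t z \<longrightarrow> E t (i x)"
    then obtain y where y: "z = i y" using sub by blast
    have "\<forall>t. E t y \<longrightarrow> E t x" using z unfolding y members using i(1) by blast
    with * y show "P z" by blast
  qed
  have IH: "sat UNIV E (case_nat (i x) (\<lambda>n. i (e n))) p \<longleftrightarrow> sat UNIV E (case_nat x e) p"
    if "\<And>e. sat UNIV E e p \<longleftrightarrow> sat UNIV E (\<lambda>n. i (e n)) p" for e p x
    using that[of "case_nat x e"] by (simp only: case_nat_i)
  {
    case (1 i j) then show ?case using i(1) by simp
  next
    case (2 i j) then show ?case using i(2) by (simp add: inj_eq)
  next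
    case (7 p y)
    have "sat UNIV E e (Exists_mem y p) \<longleftrightarrow> \<not> (\<forall>x. E x (e y) \<longrightarrow> \<not> sat UNIV E (case_nat x e) p)" for e
      by simp
    from this[of e] this[of "\<lambda>n. i (e n)"] show ?case
      unfolding members IH[OF 7(2)] by blast
  next
    case (8 p y)
    have "sat UNIV E e (Forall_mem y p) \<longleftrightarrow> (\<forall>x. E x (e y) \<longrightarrow> sat UNIV E (case_nat x e) p)" for e
      by simp
    from this[of e] this[of "\<lambda>n. i (e n)"] show ?case
      unfolding members IH[OF 8(2)] by blast
  next
    case (9 p y)
    have "sat UNIV E e (Exists_sub y p) \<longleftrightarrow>
       \<not> (\<forall>x. (\<forall>t. E t x \<longrightarrow> E t (e y)) \<longrightarrow> \<not> sat UNIV E (case_nat x e) p)" for e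
      by simp
    from this[of e] this[of "\<lambda>n. i (e n)"] show ?case
      unfolding subsets IH[OF 9(2)] by blast
  next
    case (10 p y)
    have "sat UNIV E e (Forall_sub y p) \<longleftrightarrow>
       (\<forall>x. (\<forall>t. E t x \<longrightarrow> E t (e y)) \<longrightarrow> sat UNIV E (case_nat x e) p)" for e
      by simp
    from this[of e] this[of "\<lambda>n. i (e n)"] show ?case
      unfolding subsets IH[OF 10(2)] by blast
  }
qed simp_all

lemma sat_finitely_many_variables:
  "\<exists>N. \<forall>e e'. (\<forall>n<N. e n = e' n) \<longrightarrow> sat M E e p = sat M E e' p"
proof (induction p)
  have both: "\<exists>N. \<forall>e e'. (\<forall>n<N. e n = e' n) \<longrightarrow>
      sat M E e p = sat M E e' p \<and> sat M E e q = sat M E e' q"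
    if "\<exists>N. \<forall>e e'. (\<forall>n<N. e n = e' n) \<longrightarrow> sat M E e p = sat M E e' p"
      and "\<exists>N. \<forall>e e'. (\<forall>n<N. e n = e' n) \<longrightarrow> sat M E e q = sat M E e' q" for p q
  proof -
    from that obtain N N' where
      N: "\<And>e e'. (\<forall>n<N. e n = e' n) \<Longrightarrow> sat M E e p = sat M E e' p" and
      N': "\<And>e e'. (\<forall>n<N'. e n = e' n) \<Longrightarrow> sat M E e q = sat M E e' q" by blast
    have "sat M E e p = sat M E e' p \<and> sat M E e q = sat M E e' q"
      if "\<forall>n<max N N'. e n = e' n" for e e'
      using N[of e e'] N'[of e e'] that by simp
    then show ?thesis by blast
  qed
  {
  case (Mem i j) show ?case by (rule exI[of _ "Suc (max i j)"]) (auto simp: less_Suc_eq_le)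
next
  case (Eql i j) show ?case by (rule exI[of _ "Suc (max i j)"]) (auto simp: less_Suc_eq_le)
next
  case (And p q)
  obtain N where N: "\<And>e e'. (\<forall>n<N. e n = e' n) \<Longrightarrow>
      sat M E e p = sat M E e' p \<and> sat M E e q = sat M E e' q"
    using both[OF And] by blast
  have "sat M E e (And p q) = sat M E e' (And p q)" if "\<forall>n<N. e n = e' n" for e e'
    using N[OF that] by simp
  then show ?case by blast
next
  case (Or p q)
  obtain N where N: "\<And>e e'. (\<forall>n<N. e n = e' n) \<Longrightarrow>
      sat M E e p = sat M E e' p \<and> sat M E e q = sat M E e' q"
    using both[OF Or] by blast
  have "sat M E e (Or p q) = sat M E e' (Or p q)" if "\<forall>n<N. e n = e' n" for e e'
    using N[OF that] by simp
  then show ?case by blast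
next
  case (Imp p q)
  obtain N where N: "\<And>e e'. (\<forall>n<N. e n = e' n) \<Longrightarrow>
      sat M E e p = sat M E e' p \<and> sat M E e q = sat M E e' q"
    using both[OF Imp] by blast
  have "sat M E e (Imp p q) = sat M E e' (Imp p q)" if "\<forall>n<N. e n = e' n" for e e'
    using N[OF that] by simp
  then show ?case by blast
next
  case (Forall p)
  then obtain N where N: "\<And>e e'. (\<forall>n<N. e n = e' n) \<Longrightarrow> sat M E e p = sat M E e' p" by blast
  have "sat M E e (Forall p) = sat M E e' (Forall p)" if e: "\<forall>n<N. e n = e' n" for e e'
  proof -
    have "sat M E (case_nat x e) p = sat M E (case_nat x e') p" for x
      by (rule N) (use e in \<open>auto split: nat.split\<close>)
    then show ?thesis by simp
  qed
  then show ?case by blast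
next
  case (Exists p)
  then obtain N where N: "\<And>e e'. (\<forall>n<N. e n = e' n) \<Longrightarrow> sat M E e p = sat M E e' p" by blast
  have "sat M E e (Exists p) = sat M E e' (Exists p)" if e: "\<forall>n<N. e n = e' n" for e e'
  proof -
    have "sat M E (case_nat x e) p = sat M E (case_nat x e') p" for x
      by (rule N) (use e in \<open>auto split: nat.split\<close>)
    then show ?thesis by simp
  qed
  then show ?case by blast
  }
qed auto

context kpp begin

lemma delta0_elementary:
  assumes "self_embedding UNIV E i"
    and "\<And>x z. z \<epsilon> i x \<or> z \<sqsubseteq> i x \<Longrightarrow> z \<in> range i"
    and "delta0 R"
  shows "R e \<longleftrightarrow> R (\<lambda>n. i (e n))"
proof -
  from assms(3) obtain p where p: "p \<in> Delta0P" "\<And>e. sat UNIV E e p \<longleftrightarrow> R e"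
    unfolding delta0_def by blast
  have "sat UNIV E e p \<longleftrightarrow> sat UNIV E (\<lambda>n. i (e n)) p"
    by (rule Delta0P_elementary)
      (use assms(1,2) p in \<open>auto simp: self_embedding_def subs_def\<close>)
  then show ?thesis by (simp add: p)
qed

text \<open>A subset of \<open>i x\<close> has a rank included in that of \<open>i x\<close>, which by linearity leaves only equality
  and membership.\<close>

lemma rank_initial_closed:
  assumes "rank_initial UNIV E i" and "z \<epsilon> i x \<or> z \<sqsubseteq> i x"
  shows "z \<in> range i"
proof -
  have "rnk z \<epsilon> rnk (i x) \<or> rnk z = rnk (i x)"
  proof (cases "z \<epsilon> i x")
    case True
    then show ?thesis by (simp add: rnk_mem)
  next
    case False
    then have "rnk z \<sqsubseteq> rnk (i x)" using assms(2) rnk_subs by blast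
    then have "\<not> rnk (i x) \<epsilon> rnk z" using subsD[of "rnk z" "rnk (i x)" "rnk (i x)"] by auto
    then show ?thesis using ord_linear[OF ord_rnk[of z] ord_rnk[of "i x"]] by blast
  qed
  then show ?thesis using assms(1) unfolding rank_initial_def rank_eq by blast
qed

text \<open>Only finitely many values of an assignment matter to a formula, and these have a common bound on
  their ranks: the rank of a set that contains them.\<close>

lemma exists_set_of_first: "\<exists>c. \<forall>n<(N::nat). e n \<epsilon> c"
proof (induction N)
  case (Suc N)
  then obtain c where "\<forall>n<N. e n \<epsilon> c" by blast
  then show ?case by (intro exI[of _ "union c (upair (e N) (e N))"]) (auto simp: less_Suc_eq)
qed simp

text \<open>If \<open>n\<close> is outside the range, then every \<open>i m\<close> has smaller rank than \<open>n\<close>. So the level \<open>B\<close> of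
  the hierarchy at the rank of \<open>n\<close> bounds the existential quantifier.\<close>

lemma separation_if_embeddings:
  assumes emb: "\<And>\<alpha>. \<alpha> \<in> Ord_in UNIV E \<Longrightarrow> \<exists>i. self_embedding UNIV E i \<and> range i \<noteq> UNIV \<and>
      rank_initial UNIV E i \<and> (\<forall>m\<in>below_rank UNIV E \<alpha>. i m = m)"
  shows "separation (SigmaP 1) UNIV E"
  unfolding separation_def
proof (intro ballI)
  fix q :: fm and e :: "nat \<Rightarrow> 'a" and x
  assume "q \<in> SigmaP 1"
  then obtain p where p: "p \<in> Delta0P" "q = Exists p" by auto
  obtain N where N: "\<And>e e'. (\<forall>n<N. e n = e' n) \<Longrightarrow> sat UNIV E e p = sat UNIV E e' p"
    using sat_finitely_many_variables by blast
  obtain c' where c': "\<forall>n<N. e n \<epsilon> c'" using exists_set_of_first by blast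
  define \<alpha> where "\<alpha> = rnk (union c' (upair x x))"
  have below: "m \<in> below_rank UNIV E \<alpha> \<longleftrightarrow> rnk m \<epsilon> \<alpha>" for m
    by (simp add: below_rank_def rank_eq)
  have e: "rnk (e n) \<epsilon> \<alpha>" if "n < N" for n using that c' by (auto simp: \<alpha>_def intro: rnk_mem)
  have "rnk x \<epsilon> \<alpha>" by (auto simp: \<alpha>_def intro: rnk_mem)
  moreover have "transitive \<alpha>" using ord_rnk unfolding \<alpha>_def ord_def by blast
  ultimately have x: "rnk z \<epsilon> \<alpha>" if "z \<epsilon> x" for z
    using rnk_mem[OF that] transitiveD[of \<alpha> "rnk x" "rnk z"] by blast
  have "\<alpha> \<in> Ord_in UNIV E" unfolding \<alpha>_def by (rule rnk_in_Ord_in)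
  from emb[OF this] obtain i where i: "self_embedding UNIV E i" "range i \<noteq> UNIV"
    "rank_initial UNIV E i" and fix_i: "\<And>m. rnk m \<epsilon> \<alpha> \<Longrightarrow> i m = m"
    unfolding below[symmetric] by blast
  from i(2) obtain n where n: "n \<notin> range i" by blast
  have bound: "i m \<epsilon> hier empty (rnk n)" for m
  proof (rule rnk_mem_hier)
    have "\<not> (rnk n \<epsilon> rnk (i m) \<or> rnk n = rnk (i m))"
      using i(3) n unfolding rank_initial_def by (auto simp: rank_eq)
    then show "rnk (i m) \<epsilon> rnk n" using ord_linear[OF ord_rnk[of n] ord_rnk[of "i m"]] by blast
  qed
  define B where "B = hier empty (rnk n)"
  define c where "c = case_nat B e"
  have del: "delta0 (\<lambda>d. sat UNIV E d p)" using p(1) unfolding delta0_def by blast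
  have "delta0 (\<lambda>d. sat UNIV E (case_nat (d 0) (case_nat (d (Suc 0)) (\<lambda>n. d (Suc (Suc (Suc n)))))) p)"
  proof -
    have "case_nat (d 0) (case_nat (d 1) (\<lambda>n. d (Suc (Suc (Suc n))))) =
        (\<lambda>n. d (case_nat 0 (case_nat 1 (\<lambda>n. Suc (Suc (Suc n)))) n))" for d :: "nat \<Rightarrow> 'a"
      by (auto simp: fun_eq_iff split: nat.split)
    then show ?thesis using delta0_rename[OF del] by simp
  qed
  then have "delta0 (\<lambda>d. \<exists>w. w \<epsilon> d (Suc 0) \<and>
      sat UNIV E (case_nat w (case_nat (d 0) (\<lambda>n. d (Suc (Suc n))))) p)"
    by (intro delta0_ex_mem)
  then obtain r where r: "r \<in> Delta0P" "\<And>d. sat UNIV E d r \<longleftrightarrow> (\<exists>w. w \<epsilon> d (Suc 0) \<and>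
      sat UNIV E (case_nat w (case_nat (d 0) (\<lambda>n. d (Suc (Suc n))))) p)"
    unfolding delta0_def by blast
  have "separation Delta0P UNIV E" using models unfolding models_KPP_def by simp
  then have "\<forall>e\<in>UNIV \<rightarrow> UNIV. \<forall>x\<in>UNIV. \<exists>y\<in>UNIV. \<forall>z\<in>UNIV.
     E z y \<longleftrightarrow> E z x \<and> sat UNIV E (case_nat z e) r"
    unfolding separation_def using r(1) by (rule bspec)
  then obtain y where y: "\<And>z. z \<epsilon> y \<longleftrightarrow> z \<epsilon> x \<and> sat UNIV E (case_nat z c) r" by force
  have "sat UNIV E (case_nat z c) r \<longleftrightarrow> sat UNIV E (case_nat z e) q" if z: "z \<epsilon> x" for z
  proof -
    have "\<exists>w. w \<epsilon> B \<and> sat UNIV E (case_nat w (case_nat z e)) p"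
      if "sat UNIV E (case_nat w (case_nat z e)) p" for w
    proof -
      define d where "d = case_nat w (case_nat z e)"
      have "sat UNIV E (\<lambda>n. i (d n)) p"
        using delta0_elementary[OF i(1) rank_initial_closed[OF i(3)] del, where e = d] that
        by (simp add: d_def)
      also have "sat UNIV E (\<lambda>n. i (d n)) p = sat UNIV E (case_nat (i w) (case_nat z e)) p"
        by (rule N) (auto simp: d_def fix_i[OF x[OF z]] fix_i[OF e] split: nat.split)
      finally show ?thesis using bound unfolding B_def by blast
    qed
    then show ?thesis by (auto simp: r p c_def)
  qed
  with y show "\<exists>y\<in>UNIV. \<forall>z\<in>UNIV. z \<epsilon> y \<longleftrightarrow> z \<epsilon> x \<and> sat UNIV E (case_nat z e) q" by auto
qed

section \<open>Infinitary codes and strategies\<close>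

text \<open>Assignments of values to names are sets of pairs \<open>\<langle>name, value\<rangle>\<close> in the model.\<close>

definition extend :: "'a \<Rightarrow> 'a \<Rightarrow> 'a \<Rightarrow> 'a" where
  "extend e c y = union e (upair \<langle>c, y\<rangle> \<langle>c, y\<rangle>)"

lemma mem_extend: "q \<epsilon> extend e c y \<longleftrightarrow> q \<epsilon> e \<or> q = \<langle>c, y\<rangle>"
  unfolding extend_def by simp

lemma delta0_eq_extend: "delta0 (\<lambda>e. e i = extend (e j) (e k) (e l))"
proof -
  have *: "e' = extend e c y \<longleftrightarrow> (\<forall>q. q \<epsilon> e' \<longrightarrow> q \<epsilon> e \<or> q = \<langle>c, y\<rangle>) \<and> e \<sqsubseteq> e' \<and> \<langle>c, y\<rangle> \<epsilon> e'"
    for e e' c y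
  proof
    assume *: "(\<forall>q. q \<epsilon> e' \<longrightarrow> q \<epsilon> e \<or> q = \<langle>c, y\<rangle>) \<and> e \<sqsubseteq> e' \<and> \<langle>c, y\<rangle> \<epsilon> e'"
    show "e' = extend e c y"
      by (rule ext) (use * in \<open>auto simp: mem_extend subs_def\<close>)
  qed (simp add: mem_extend subs_def)
  show ?thesis unfolding * by (intro delta0_intros)
qed

lemma delta0_extend_mem: "delta0 (\<lambda>e. \<langle>e i, extend (e j) (e k) (e l)\<rangle> \<epsilon> e m)"
proof -
  have *: "\<langle>t, extend e c y\<rangle> \<epsilon> W \<longleftrightarrow> (\<exists>e'. \<langle>t, e'\<rangle> \<epsilon> W \<and> e' = extend e c y)" for t e c y W
    by blast
  show ?thesis unfolding * by (intro delta0_ex_value delta0_eq_extend)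
qed

text \<open>One step of the truth definition for the code \<open>\<langle>c, \<langle>d, D\<rangle>\<rangle>\<close> at the assignment \<open>e\<close>, where \<open>W\<close>
  decides the codes in \<open>D\<close>. In an atom, \<open>D\<close> only tells a positive (nonempty) from a negative
  (empty) one. In the existential case, demanding one code \<open>t\<close> verified at \<open>e'\<close> bounds the
  quantifier over \<open>y\<close> by \<open>W\<close>.\<close>

definition verified :: "'a \<Rightarrow> 'a \<Rightarrow> 'a \<Rightarrow> 'a \<Rightarrow> 'a \<Rightarrow> bool" where
  "verified W c d D e \<longleftrightarrow>
    (if \<exists>u. \<langle>c, u\<rangle> \<epsilon> e
     then \<exists>u. \<langle>c, u\<rangle> \<epsilon> e \<and> (\<exists>v. \<langle>d, v\<rangle> \<epsilon> e \<and> (u \<epsilon> v \<longleftrightarrow> (\<exists>t. t \<epsilon> D)))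
     else if \<exists>v. \<langle>d, v\<rangle> \<epsilon> e
     then \<forall>v. \<langle>d, v\<rangle> \<epsilon> e \<longrightarrow>
       (\<forall>y. y \<epsilon> v \<longrightarrow> (\<exists>t. t \<epsilon> D \<and> \<langle>t, extend e c y\<rangle> \<epsilon> W)) \<and>
       (\<forall>y. y \<sqsubseteq> v \<longrightarrow> (\<exists>t. t \<epsilon> D \<and> \<langle>t, extend e c y\<rangle> \<epsilon> W))
     else \<exists>t e'. \<langle>t, e'\<rangle> \<epsilon> W \<and> (\<exists>y. \<langle>c, y\<rangle> \<epsilon> e' \<and> e' = extend e c y \<and>
       (\<forall>t. t \<epsilon> D \<longrightarrow> \<langle>t, e'\<rangle> \<epsilon> W)))"

lemma delta0_verified: "delta0 (\<lambda>e. verified (e i) (e j) (e k) (e l) (e m))"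
  unfolding verified_def
  by (intro delta0_if delta0_has_value delta0_ex_value delta0_all_value delta0_conj delta0_iff
      delta0_mem delta0_nonempty delta0_all_mem delta0_all_subs delta0_ex_mem delta0_extend_mem
      delta0_ex_kpair delta0_eq_extend delta0_kpair_mem)

lemma verified_mono:
  assumes "verified W c d D e" and sub: "W \<sqsubseteq> W'"
  shows "verified W' c d D e"
proof (cases "\<exists>u. \<langle>c, u\<rangle> \<epsilon> e")
  case True
  then show ?thesis using assms(1) unfolding verified_def by simp
next
  case c: False
  show ?thesis
  proof (cases "\<exists>v. \<langle>d, v\<rangle> \<epsilon> e")
    case True
    then show ?thesis using assms(1) subsD[OF sub] c
      unfolding verified_def if_P[OF True] if_not_P[OF c] by meson
  next
    case False
    then show ?thesis using assms(1) subsD[OF sub] c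
      unfolding verified_def if_not_P[OF False] if_not_P[OF c] by blast
  qed
qed

text \<open>The definition is coinductive in form: any set closed under the demands of \<open>verified\<close> is
  admitted. So a code holds if and only if some set witnesses it, which is a \<open>\<Sigma>\<^sub>1\<close> condition.\<close>

definition strategy :: "'a \<Rightarrow> bool" where
  "strategy W \<longleftrightarrow> (\<forall>a e. \<langle>a, e\<rangle> \<epsilon> W \<longrightarrow>
     (\<forall>c b. a = \<langle>c, b\<rangle> \<longrightarrow> (\<forall>d D. b = \<langle>d, D\<rangle> \<longrightarrow> verified W c d D e)))"

lemma delta0_strategy: "delta0 (\<lambda>e. strategy (e i))"
  unfolding strategy_def by (intro delta0_all_kpair delta0_all_components delta0_verified)

lemma strategyD: "strategy W \<Longrightarrow> \<langle>\<langle>c, \<langle>d, D\<rangle>\<rangle>, e\<rangle> \<epsilon> W \<Longrightarrow> verified W c d D e"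
  unfolding strategy_def by blast

lemma strategy_empty: "strategy empty"
  unfolding strategy_def by simp

lemma strategy_bigunion:
  assumes "\<And>W. W \<epsilon> F \<Longrightarrow> strategy W"
  shows "strategy (bigunion F)"
  unfolding strategy_def
proof (intro allI impI)
  fix a e c b d D
  assume *: "\<langle>a, e\<rangle> \<epsilon> bigunion F" and a: "a = \<langle>c, b\<rangle>" "b = \<langle>d, D\<rangle>"
  then obtain W where W: "W \<epsilon> F" "\<langle>\<langle>c, \<langle>d, D\<rangle>\<rangle>, e\<rangle> \<epsilon> W" by auto
  have "W \<sqsubseteq> bigunion F" using W(1) unfolding subs_def by auto
  then show "verified (bigunion F) c d D e"
    using verified_mono[OF strategyD[OF assms[OF W(1)] W(2)]] by blast
qed

definition holds :: "'a \<Rightarrow> 'a \<Rightarrow> bool" where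
  "holds a e \<longleftrightarrow> (\<exists>W. strategy W \<and> \<langle>a, e\<rangle> \<epsilon> W)"

lemma sigma1_holds: "sigma1 (\<lambda>e. holds (e i) (e j))"
  unfolding holds_def by (intro sigma1_ex_delta0 delta0_conj delta0_strategy delta0_kpair_mem)

lemma holdsI:
  assumes W: "strategy W" and v: "verified W c d D e"
  shows "holds \<langle>c, \<langle>d, D\<rangle>\<rangle> e"
proof -
  define q where "q = \<langle>\<langle>c, \<langle>d, D\<rangle>\<rangle>, e\<rangle>"
  define W' where "W' = union W (upair q q)"
  have sub: "W \<sqsubseteq> W'" and q: "q \<epsilon> W'" unfolding W'_def subs_def by simp_all
  have "strategy W'"
    unfolding strategy_def
  proof (intro allI impI)
    fix a' e' c' b' d' D'
    assume *: "\<langle>a', e'\<rangle> \<epsilon> W'" and a: "a' = \<langle>c', b'\<rangle>" "b' = \<langle>d', D'\<rangle>"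
    then consider "\<langle>\<langle>c', \<langle>d', D'\<rangle>\<rangle>, e'\<rangle> \<epsilon> W" | "c' = c" "d' = d" "D' = D" "e' = e"
      unfolding W'_def q_def by auto
    then show "verified W' c' d' D' e'"
    proof cases
      case 1
      from verified_mono[OF strategyD[OF W 1] sub] show ?thesis .
    next
      case 2
      then show ?thesis using verified_mono[OF v sub] by simp
    qed
  qed
  with q show ?thesis unfolding holds_def q_def by blast
qed

text \<open>Collection gives a set of strategies, and their union is a strategy.\<close>

lemma collect_strategies:
  assumes R: "delta0 R"
    and ex: "\<And>u. u \<epsilon> X \<Longrightarrow> \<exists>W. strategy W \<and> R ((!) (u # W # ps))"
    and mono: "\<And>u W W'. R ((!) (u # W # ps)) \<Longrightarrow> W \<sqsubseteq> W' \<Longrightarrow> R ((!) (u # W' # ps))"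
  shows "\<exists>W. strategy W \<and> (\<forall>u. u \<epsilon> X \<longrightarrow> R ((!) (u # W # ps)))"
proof -
  have "delta0 (\<lambda>e. strategy (e (Suc 0)) \<and> R e)" by (intro delta0_conj delta0_strategy R)
  from collection0[OF this, of X ps] ex obtain G where
    G: "\<And>u. u \<epsilon> X \<Longrightarrow> \<exists>W. W \<epsilon> G \<and> strategy W \<and> R ((!) (u # W # ps))" by auto
  have "delta0 (\<lambda>e. strategy (e 0))" by (rule delta0_strategy)
  from separation0[OF this, of G "[]"] obtain F where
    F: "\<And>W. W \<epsilon> F \<longleftrightarrow> W \<epsilon> G \<and> strategy W" by auto
  have "strategy (bigunion F)" by (rule strategy_bigunion) (simp add: F)
  moreover have "R ((!) (u # bigunion F # ps))" if u: "u \<epsilon> X" for u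
  proof -
    from G[OF u] obtain W where W: "W \<epsilon> F" "R ((!) (u # W # ps))" using F by blast
    have "W \<sqsubseteq> bigunion F" using W(1) unfolding subs_def by auto
    then show ?thesis by (rule mono[OF W(2)])
  qed
  ultimately show ?thesis by blast
qed

lemma collect_holds:
  assumes "\<And>t. t \<epsilon> D \<Longrightarrow> holds t e"
  shows "\<exists>W. strategy W \<and> (\<forall>t. t \<epsilon> D \<longrightarrow> \<langle>t, e\<rangle> \<epsilon> W)"
proof -
  have "delta0 (\<lambda>e. \<langle>e 0, e (Suc (Suc 0))\<rangle> \<epsilon> e (Suc 0))" by (rule delta0_kpair_mem)
  from collect_strategies[OF this, of D "[e]"] show ?thesis
    using assms unfolding holds_def by (auto dest: subsD)
qed

end

section \<open>Back and forth\<close>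

text \<open>Stage \<open>k\<close> of the construction concerns codes in \<open>P k\<close>. Names are the elements of \<open>s\<close> and, one
  for each stage, the fresh names \<open>nm k\<close>. All names belong to every \<open>P k\<close>, so that they can occur in
  codes at every stage.\<close>

locale back_and_forth = kpp +
  fixes s :: 'a and P :: "nat \<Rightarrow> 'a" and nm :: "nat \<Rightarrow> 'a"
  assumes sigma1_sep: "separation (SigmaP 1) UNIV E"
    and code_P: "\<And>c d D k. c \<epsilon> P (Suc k) \<Longrightarrow> d \<epsilon> P (Suc k) \<Longrightarrow> D \<sqsubseteq> P (Suc k) \<Longrightarrow>
      \<langle>c, \<langle>d, D\<rangle>\<rangle> \<epsilon> P k"
    and base_P: "\<And>c k. c \<epsilon> s \<Longrightarrow> c \<epsilon> P k"
    and nm_P: "\<And>j k. nm j \<epsilon> P k"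
    and nm_new: "\<And>j. \<not> nm j \<epsilon> s"
    and inj_nm: "inj nm"
begin

definition state :: "nat \<Rightarrow> 'a \<Rightarrow> bool" where
  "state k e \<longleftrightarrow> (\<forall>c. (\<exists>x. \<langle>c, x\<rangle> \<epsilon> e) \<longleftrightarrow> c \<epsilon> s \<or> (\<exists>j<k. c = nm j)) \<and>
     (\<forall>c x y. \<langle>c, x\<rangle> \<epsilon> e \<longrightarrow> \<langle>c, y\<rangle> \<epsilon> e \<longrightarrow> x = y)"

lemma state_dom: "state k e \<Longrightarrow> (\<exists>x. \<langle>c, x\<rangle> \<epsilon> e) \<longleftrightarrow> c \<epsilon> s \<or> (\<exists>j<k. c = nm j)"
  unfolding state_def by blast

lemma state_unique: "state k e \<Longrightarrow> \<langle>c, x\<rangle> \<epsilon> e \<Longrightarrow> \<langle>c, y\<rangle> \<epsilon> e \<Longrightarrow> x = y"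
  unfolding state_def by blast

lemma state_P: "state k e \<Longrightarrow> \<langle>c, x\<rangle> \<epsilon> e \<Longrightarrow> c \<epsilon> P j"
  using state_dom[of k e c] base_P nm_P by blast

lemma state_fresh: "state k e \<Longrightarrow> \<not> \<langle>nm k, x\<rangle> \<epsilon> e"
proof
  assume "state k e" "\<langle>nm k, x\<rangle> \<epsilon> e"
  then have "nm k \<epsilon> s \<or> (\<exists>j<k. nm k = nm j)" using state_dom by blast
  then show False using nm_new inj_nm by (auto simp: inj_eq)
qed

lemma state_extend:
  assumes "state k e"
  shows "state (Suc k) (extend e (nm k) y)"
  unfolding state_def mem_extend kpair_inject
proof (intro conjI allI impI)
  fix c
  show "(\<exists>x. \<langle>c, x\<rangle> \<epsilon> e \<or> c = nm k \<and> x = y) \<longleftrightarrow> c \<epsilon> s \<or> (\<exists>j<Suc k. c = nm j)"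
    using state_dom[OF assms, of c] by (auto simp: less_Suc_eq)
next
  fix c x x' assume "\<langle>c, x\<rangle> \<epsilon> e \<or> c = nm k \<and> x = y" "\<langle>c, x'\<rangle> \<epsilon> e \<or> c = nm k \<and> x' = y"
  then show "x = x'" using state_fresh[OF assms] state_unique[OF assms, of c x x'] by blast
qed

lemma verified_atom:
  assumes e: "state k e" and c: "\<langle>c, u\<rangle> \<epsilon> e" and d: "\<langle>d, v\<rangle> \<epsilon> e"
  shows "verified W c d D e \<longleftrightarrow> (u \<epsilon> v \<longleftrightarrow> (\<exists>t. t \<epsilon> D))"
proof -
  have "\<langle>c, x\<rangle> \<epsilon> e \<longleftrightarrow> x = u" "\<langle>d, x\<rangle> \<epsilon> e \<longleftrightarrow> x = v" for x
    using state_unique[OF e] c d by blast+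
  then show ?thesis unfolding verified_def by simp
qed

lemma verified_ex:
  assumes e: "state k e"
  shows "verified W (nm k) (nm k) D e \<longleftrightarrow>
    (\<exists>t y. \<langle>t, extend e (nm k) y\<rangle> \<epsilon> W \<and> (\<forall>t. t \<epsilon> D \<longrightarrow> \<langle>t, extend e (nm k) y\<rangle> \<epsilon> W))"
proof -
  have new: "\<not> (\<exists>x. \<langle>nm k, x\<rangle> \<epsilon> e)" using state_fresh[OF e] by blast
  have "\<langle>nm k, y\<rangle> \<epsilon> extend e (nm k) y" for y by (simp add: mem_extend)
  then show ?thesis unfolding verified_def if_not_P[OF new] by blast
qed

lemma verified_all:
  assumes e: "state k e" and d: "\<langle>d, v\<rangle> \<epsilon> e"
  shows "verified W (nm k) d D e \<longleftrightarrow>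
    (\<forall>y. y \<epsilon> v \<or> y \<sqsubseteq> v \<longrightarrow> (\<exists>t. t \<epsilon> D \<and> \<langle>t, extend e (nm k) y\<rangle> \<epsilon> W))"
proof -
  have "\<not> (\<exists>x. \<langle>nm k, x\<rangle> \<epsilon> e)" using state_fresh[OF e] by blast
  moreover have "\<langle>d, x\<rangle> \<epsilon> e \<longleftrightarrow> x = v" for x
    using state_unique[OF e] d by blast
  ultimately show ?thesis unfolding verified_def by auto
qed

lemma holds_atom:
  assumes "state k e" "\<langle>c, u\<rangle> \<epsilon> e" "\<langle>d, v\<rangle> \<epsilon> e" "u \<epsilon> v \<longleftrightarrow> (\<exists>t. t \<epsilon> D)"
  shows "holds \<langle>c, \<langle>d, D\<rangle>\<rangle> e"
  using holdsI[OF strategy_empty] verified_atom[OF assms(1-3)] assms(4) by blast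

definition simulates :: "'a \<Rightarrow> nat \<Rightarrow> 'a \<Rightarrow> 'a \<Rightarrow> bool" where
  "simulates W k e e' \<longleftrightarrow> state k e \<and> state k e' \<and> (\<forall>a. a \<epsilon> P k \<longrightarrow> holds a e \<longrightarrow> \<langle>a, e'\<rangle> \<epsilon> W)"

text \<open>The set \<open>D\<close> of all codes that hold after adding \<open>y\<close> is turned into the single existential code
  \<open>\<langle>nm k, \<langle>nm k, D\<rangle>\<rangle>\<close>. It holds at \<open>e\<close>, so \<open>W\<close> verifies it at \<open>e'\<close>, and this produces \<open>y'\<close>.\<close>

lemma forth_step:
  assumes W: "strategy W" and sim: "simulates W k e e'"
  shows "\<exists>y'. simulates W (Suc k) (extend e (nm k) y) (extend e' (nm k) y')"
proof -
  let ?c = "nm k" and ?f = "extend e (nm k) y"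
  have e: "state k e" "state k e'" using sim unfolding simulates_def by blast+
  have f: "state (Suc k) ?f" by (rule state_extend[OF e(1)])
  have cf: "\<langle>?c, y\<rangle> \<epsilon> ?f" by (simp add: mem_extend)
  have "sigma1 (\<lambda>e. holds (e 0) (e 1))" by (rule sigma1_holds)
  from separation1[OF sigma1_sep this, of "P (Suc k)" "[?f]"]
  obtain D where D: "\<And>t. t \<epsilon> D \<longleftrightarrow> t \<epsilon> P (Suc k) \<and> holds t ?f" by auto
  from collect_holds[of D ?f] D obtain W\<^sub>0 where
    W\<^sub>0: "strategy W\<^sub>0" "\<And>t. t \<epsilon> D \<Longrightarrow> \<langle>t, ?f\<rangle> \<epsilon> W\<^sub>0" by blast
  \<comment> \<open>A negative atom, true since no set is an element of itself. It shows that \<open>D\<close> is nonempty.\<close>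
  have "holds \<langle>?c, \<langle>?c, empty\<rangle>\<rangle> ?f" by (rule holds_atom[OF f cf cf]) simp
  moreover have "\<langle>?c, \<langle>?c, empty\<rangle>\<rangle> \<epsilon> P (Suc k)" by (rule code_P[OF nm_P nm_P]) (simp add: subs_def)
  ultimately have "\<langle>?c, \<langle>?c, empty\<rangle>\<rangle> \<epsilon> D" unfolding D by blast
  then have "verified W\<^sub>0 ?c ?c D e" unfolding verified_ex[OF e(1)] using W\<^sub>0(2) by blast
  then have "holds \<langle>?c, \<langle>?c, D\<rangle>\<rangle> e" by (rule holdsI[OF W\<^sub>0(1)])
  moreover have "\<langle>?c, \<langle>?c, D\<rangle>\<rangle> \<epsilon> P k" by (rule code_P[OF nm_P nm_P]) (simp add: subs_def D)
  ultimately have "\<langle>\<langle>?c, \<langle>?c, D\<rangle>\<rangle>, e'\<rangle> \<epsilon> W" using sim unfolding simulates_def by blast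
  from strategyD[OF W this] obtain y' where "\<And>t. t \<epsilon> D \<Longrightarrow> \<langle>t, extend e' ?c y'\<rangle> \<epsilon> W"
    unfolding verified_ex[OF e(2)] by blast
  then have "simulates W (Suc k) ?f (extend e' ?c y')"
    unfolding simulates_def using f state_extend[OF e(2)] D by blast
  then show ?thesis ..
qed

text \<open>Let \<open>D\<close> consist of the codes not verified after adding \<open>z\<close> on the right. If every element or
  subset \<open>y\<close> of the value of \<open>d\<close> on the left made some code in \<open>D\<close> hold, then the universal code
  \<open>\<langle>nm k, \<langle>d, D\<rangle>\<rangle>\<close> would hold at \<open>e\<close>, so \<open>W\<close> would verify it at \<open>e'\<close>, and some code in \<open>D\<close> would be
  verified for \<open>z\<close> after all.\<close>

lemma back_step:
  assumes W: "strategy W" and sim: "simulates W k e e'"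
    and d: "\<langle>d, v'\<rangle> \<epsilon> e'" and z: "z \<epsilon> v' \<or> z \<sqsubseteq> v'"
  shows "\<exists>y. simulates W (Suc k) (extend e (nm k) y) (extend e' (nm k) z)"
proof -
  let ?c = "nm k" and ?f = "extend e' (nm k) z"
  have e: "state k e" "state k e'" using sim unfolding simulates_def by blast+
  obtain v where v: "\<langle>d, v\<rangle> \<epsilon> e" using d state_dom[OF e(1), of d] state_dom[OF e(2), of d] by blast
  have "delta0 (\<lambda>e. \<not> \<langle>e 0, e 2\<rangle> \<epsilon> e 1)" by (intro delta0_intros)
  from separation0[OF this, of "P (Suc k)" "[W, ?f]"]
  obtain D where D: "\<And>t. t \<epsilon> D \<longleftrightarrow> t \<epsilon> P (Suc k) \<and> \<not> \<langle>t, ?f\<rangle> \<epsilon> W" by auto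
  have "\<exists>y. (y \<epsilon> v \<or> y \<sqsubseteq> v) \<and> (\<forall>t. t \<epsilon> D \<longrightarrow> \<not> holds t (extend e ?c y))"
  proof (rule ccontr)
    assume "\<not> ?thesis"
    then have *: "\<exists>t. t \<epsilon> D \<and> holds t (extend e ?c y)" if "y \<epsilon> union v (pow v)" for y
      using that by auto
    let ?R = "\<lambda>a. \<exists>t. t \<epsilon> a 2 \<and> \<langle>t, extend (a 3) (a 4) (a 0)\<rangle> \<epsilon> a (Suc 0)"
    have "delta0 ?R" by (intro delta0_ex_mem delta0_extend_mem)
    moreover have "\<exists>W. strategy W \<and> ?R ((!) (y # W # [D, e, ?c]))" if "y \<epsilon> union v (pow v)" for y
      using *[OF that] unfolding holds_def by auto
    moreover have "?R ((!) (y # W' # [D, e, ?c]))"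
      if "?R ((!) (y # W # [D, e, ?c]))" "W \<sqsubseteq> W'" for y W W'
      using that subsD[OF that(2)] by auto
    ultimately have "\<exists>W. strategy W \<and> (\<forall>y. y \<epsilon> union v (pow v) \<longrightarrow> ?R ((!) (y # W # [D, e, ?c])))"
      by (rule collect_strategies)
    then obtain W\<^sub>0 where W\<^sub>0: "strategy W\<^sub>0"
      "\<And>y. y \<epsilon> v \<or> y \<sqsubseteq> v \<Longrightarrow> \<exists>t. t \<epsilon> D \<and> \<langle>t, extend e ?c y\<rangle> \<epsilon> W\<^sub>0" by auto
    have "verified W\<^sub>0 ?c d D e" unfolding verified_all[OF e(1) v] using W\<^sub>0(2) by blast
    then have "holds \<langle>?c, \<langle>d, D\<rangle>\<rangle> e" by (rule holdsI[OF W\<^sub>0(1)])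
    moreover have "\<langle>?c, \<langle>d, D\<rangle>\<rangle> \<epsilon> P k"
      by (rule code_P[OF nm_P state_P[OF e(1) v]]) (simp add: subs_def D)
    ultimately have "\<langle>\<langle>?c, \<langle>d, D\<rangle>\<rangle>, e'\<rangle> \<epsilon> W" using sim unfolding simulates_def by blast
    from strategyD[OF W this] z obtain t where "t \<epsilon> D" "\<langle>t, ?f\<rangle> \<epsilon> W"
      unfolding verified_all[OF e(2) d] by blast
    then show False unfolding D by blast
  qed
  then obtain y where y: "\<And>t. t \<epsilon> D \<Longrightarrow> \<not> holds t (extend e ?c y)" by blast
  then have "simulates W (Suc k) (extend e ?c y) ?f"
    unfolding simulates_def using state_extend[OF e(1)] state_extend[OF e(2)] D by blast
  then show ?thesis ..
qed

text \<open>Both assignments start as the identity on \<open>s\<close>.\<close>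

lemma start:
  "\<exists>W e. strategy W \<and> simulates W 0 e e \<and> (\<forall>c x. \<langle>c, x\<rangle> \<epsilon> e \<longleftrightarrow> c \<epsilon> s \<and> x = c)"
proof -
  have "delta0 (\<lambda>a. \<exists>c. c \<epsilon> a 1 \<and> a 0 = \<langle>c, c\<rangle>)" by (intro delta0_intros)
  from separation0[OF this, of "pow (pow s)" "[s]"] obtain e where
    e: "\<And>q. q \<epsilon> e \<longleftrightarrow> q \<epsilon> pow (pow s) \<and> (\<exists>c. c \<epsilon> s \<and> q = \<langle>c, c\<rangle>)" by auto
  have "\<langle>c, c\<rangle> \<epsilon> pow (pow s)" if "c \<epsilon> s" for c
    using that unfolding kpair_def by (auto simp: subs_def)
  then have e: "\<langle>c, x\<rangle> \<epsilon> e \<longleftrightarrow> c \<epsilon> s \<and> x = c" for c x unfolding e by auto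
  have "sigma1 (\<lambda>e. holds (e 0) (e 1))" by (rule sigma1_holds)
  from separation1[OF sigma1_sep this, of "P 0" "[e]"]
  obtain A where A: "\<And>t. t \<epsilon> A \<longleftrightarrow> t \<epsilon> P 0 \<and> holds t e" by auto
  from collect_holds[of A e] A obtain W where "strategy W" "\<And>t. t \<epsilon> A \<Longrightarrow> \<langle>t, e\<rangle> \<epsilon> W" by blast
  moreover have "state 0 e" unfolding state_def e by simp
  ultimately show ?thesis unfolding simulates_def using A e by blast
qed

lemma simulates_mem:
  assumes W: "strategy W" and sim: "simulates W k e e'"
    and c: "\<langle>c, x\<rangle> \<epsilon> e" "\<langle>c, x'\<rangle> \<epsilon> e'" and d: "\<langle>d, y\<rangle> \<epsilon> e" "\<langle>d, y'\<rangle> \<epsilon> e'"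
  shows "x \<epsilon> y \<longleftrightarrow> x' \<epsilon> y'"
proof -
  have e: "state k e" "state k e'" using sim unfolding simulates_def by blast+
  define D where "D = (if x \<epsilon> y then upair c c else empty)"
  have D: "x \<epsilon> y \<longleftrightarrow> (\<exists>t. t \<epsilon> D)" unfolding D_def by simp
  have "D \<sqsubseteq> P (Suc k)" unfolding D_def subs_def using state_P[OF e(1) c(1)] by simp
  then have "\<langle>c, \<langle>d, D\<rangle>\<rangle> \<epsilon> P k" by (rule code_P[OF state_P[OF e(1) c(1)] state_P[OF e(1) d(1)]])
  then have "\<langle>\<langle>c, \<langle>d, D\<rangle>\<rangle>, e'\<rangle> \<epsilon> W"
    using sim holds_atom[OF e(1) c(1) d(1) D] unfolding simulates_def by blast
  from strategyD[OF W this] show ?thesis unfolding verified_atom[OF e(2) c(2) d(2)] D by blast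
qed

text \<open>Every name has a true negative atom \<open>c \<notin> c\<close>, so every right-hand assignment occurs in \<open>W\<close>.\<close>

lemma simulates_bounded:
  assumes sim: "simulates W k e e'" and c: "\<langle>c, y\<rangle> \<epsilon> e'"
  shows "y \<epsilon> bigunion (bigunion (bigunion (bigunion (bigunion W))))"
proof -
  have e: "state k e" "state k e'" using sim unfolding simulates_def by blast+
  obtain x where x: "\<langle>c, x\<rangle> \<epsilon> e" using c state_dom[OF e(1), of c] state_dom[OF e(2), of c] by blast
  have "\<langle>c, \<langle>c, empty\<rangle>\<rangle> \<epsilon> P k"
    by (rule code_P[OF state_P[OF e(1) x] state_P[OF e(1) x]]) (simp add: subs_def)
  then have W: "\<langle>\<langle>c, \<langle>c, empty\<rangle>\<rangle>, e'\<rangle> \<epsilon> W"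
    using sim holds_atom[OF e(1) x x, of empty] unfolding simulates_def by simp
  have "\<langle>c, y\<rangle> \<epsilon> bigunion (bigunion (bigunion W))"
    using kpair_mem_field(2)[OF W] c mem_bigunion by blast
  then show ?thesis by (rule kpair_mem_field(2))
qed

lemma step:
  assumes W: "strategy W" and sim: "simulates W k e e'"
  shows "\<exists>f f'. simulates W (Suc k) f f' \<and> e \<sqsubseteq> f \<and> e' \<sqsubseteq> f' \<and>
    (case task of
       Inl x \<Rightarrow> \<exists>c. \<langle>c, x\<rangle> \<epsilon> f
     | Inr (d, z) \<Rightarrow> \<forall>v. \<langle>d, v\<rangle> \<epsilon> e' \<longrightarrow> z \<epsilon> v \<or> z \<sqsubseteq> v \<longrightarrow> (\<exists>c. \<langle>c, z\<rangle> \<epsilon> f'))"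
proof -
  have sub: "e \<sqsubseteq> extend e c y" and mem: "\<langle>c, y\<rangle> \<epsilon> extend e c y" for e c y
    by (simp_all add: subs_def mem_extend)
  show ?thesis
  proof (cases task)
    case (Inl x)
    from forth_step[OF assms, of x] obtain y where
      "simulates W (Suc k) (extend e (nm k) x) (extend e' (nm k) y)" by blast
    then show ?thesis unfolding Inl sum.case using sub mem by blast
  next
    case (Inr p)
    then obtain d z where task: "task = Inr (d, z)" by (cases p) auto
    show ?thesis
    proof (cases "\<exists>v. \<langle>d, v\<rangle> \<epsilon> e' \<and> (z \<epsilon> v \<or> z \<sqsubseteq> v)")
      case True
      then obtain v where "\<langle>d, v\<rangle> \<epsilon> e'" "z \<epsilon> v \<or> z \<sqsubseteq> v" by blast
      from back_step[OF assms this] obtain y where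
        "simulates W (Suc k) (extend e (nm k) y) (extend e' (nm k) z)" by blast
      then show ?thesis unfolding task sum.case prod.case using sub mem by blast
    next
      case False
      from forth_step[OF assms, of z] obtain y where
        "simulates W (Suc k) (extend e (nm k) z) (extend e' (nm k) y)" by blast
      then show ?thesis unfolding task sum.case prod.case using sub False by blast
    qed
  qed
qed

text \<open>A task is either to put a given point into the domain or to put a given element or subset of
  the value of a given name into the range. Each of the countably many tasks comes up at arbitrarily
  late stages, when the name in it is already in use.\<close>

lemma embedding_exists:
  assumes "countable (UNIV :: 'a set)"
  shows "\<exists>i. self_embedding UNIV E i \<and> (\<forall>x z. z \<epsilon> i x \<or> z \<sqsubseteq> i x \<longrightarrow> z \<in> range i) \<and>
    range i \<noteq> UNIV \<and> (\<forall>x. x \<epsilon> s \<longrightarrow> i x = x)"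
proof -
  obtain W e\<^sub>0 where W: "strategy W" and e\<^sub>0: "simulates W 0 e\<^sub>0 e\<^sub>0"
    "\<And>c x. \<langle>c, x\<rangle> \<epsilon> e\<^sub>0 \<longleftrightarrow> c \<epsilon> s \<and> x = c" using start by blast
  have "countable (UNIV :: ('a + 'a \<times> 'a) set)"
    using assms by (metis UNIV_Plus_UNIV UNIV_Times_UNIV countable_Plus countable_SIGMA)
  then obtain g :: "nat \<Rightarrow> 'a + 'a \<times> 'a" where g: "surj g"
    using range_from_nat_into[of UNIV] by (metis UNIV_not_empty)
  define task where "task k = g (fst (prod_decode k))" for k
  have task: "\<exists>l\<ge>k. task l = t" for t k
  proof -
    obtain n where n: "g n = t" using g by (metis surjD)
    have "task (prod_encode (n, k)) = t" "k \<le> prod_encode (n, k)"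
      by (simp_all add: task_def n le_prod_encode_2)
    then show ?thesis by blast
  qed
  define performs where "performs t p q \<longleftrightarrow> fst p \<sqsubseteq> fst q \<and> snd p \<sqsubseteq> snd q \<and>
    (case t of
       Inl x \<Rightarrow> \<exists>c. \<langle>c, x\<rangle> \<epsilon> fst q
     | Inr (d, z) \<Rightarrow> \<forall>v. \<langle>d, v\<rangle> \<epsilon> snd p \<longrightarrow> z \<epsilon> v \<or> z \<sqsubseteq> v \<longrightarrow> (\<exists>c. \<langle>c, z\<rangle> \<epsilon> snd q))"
    for t :: "'a + 'a \<times> 'a" and p q :: "'a \<times> 'a"
  have "\<exists>F. \<forall>k. simulates W k (fst (F k)) (snd (F k)) \<and> performs (task k) (F k) (F (Suc k)) \<and>
      (k = 0 \<longrightarrow> F k = (e\<^sub>0, e\<^sub>0))"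
  proof -
    have "\<exists>F. \<forall>k. (simulates W k (fst (F k)) (snd (F k)) \<and> (k = 0 \<longrightarrow> F k = (e\<^sub>0, e\<^sub>0))) \<and>
        performs (task k) (F k) (F (Suc k))"
    proof (rule dependent_nat_choice)
      show "\<exists>p. simulates W 0 (fst p) (snd p) \<and> ((0::nat) = 0 \<longrightarrow> p = (e\<^sub>0, e\<^sub>0))"
        using e\<^sub>0(1) by simp
    next
      fix p k assume "simulates W k (fst p) (snd p) \<and> (k = 0 \<longrightarrow> p = (e\<^sub>0, e\<^sub>0))"
      then have "simulates W k (fst p) (snd p)" by blast
      from step[OF W this, of "task k"] obtain f f' where
        "simulates W (Suc k) f f'" "performs (task k) p (f, f')"
        unfolding performs_def fst_conv snd_conv by blast
      then show "\<exists>q. (simulates W (Suc k) (fst q) (snd q) \<and> (Suc k = 0 \<longrightarrow> q = (e\<^sub>0, e\<^sub>0))) \<and>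
          performs (task k) p q"
        by (intro exI[of _ "(f, f')"]) simp
    qed
    then show ?thesis by blast
  qed
  then obtain F where F: "\<And>k. simulates W k (fst (F k)) (snd (F k))"
    "\<And>k. performs (task k) (F k) (F (Suc k))" "F 0 = (e\<^sub>0, e\<^sub>0)" by blast
  define l where "l k = fst (F k)" for k
  define r where "r k = snd (F k)" for k
  have sim: "simulates W k (l k) (r k)" for k unfolding l_def r_def by (rule F)
  have st: "state k (l k)" "state k (r k)" for k using sim unfolding simulates_def by blast+
  have step: "l k \<sqsubseteq> l (Suc k)" "r k \<sqsubseteq> r (Suc k)" for k
    using F(2)[of k] unfolding performs_def l_def r_def by blast+
  have mono: "l k \<sqsubseteq> l m" "r k \<sqsubseteq> r m" if "k \<le> m" for k m
    using that by (induction rule: dec_induct) (use step in \<open>auto simp: subs_def\<close>)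
  define rel where "rel x y \<longleftrightarrow> (\<exists>k c. \<langle>c, x\<rangle> \<epsilon> l k \<and> \<langle>c, y\<rangle> \<epsilon> r k)" for x y
  have same_dom: "(\<exists>x. \<langle>c, x\<rangle> \<epsilon> l k) \<longleftrightarrow> (\<exists>y. \<langle>c, y\<rangle> \<epsilon> r k)" for c k
    using state_dom[OF st(1)] state_dom[OF st(2)] by simp
  have rel_mem: "x \<epsilon> y \<longleftrightarrow> x' \<epsilon> y'" if "rel x x'" "rel y y'" for x x' y y'
  proof -
    from that obtain j c k d where cd: "\<langle>c, x\<rangle> \<epsilon> l j" "\<langle>c, x'\<rangle> \<epsilon> r j" "\<langle>d, y\<rangle> \<epsilon> l k" "\<langle>d, y'\<rangle> \<epsilon> r k"
      unfolding rel_def by blast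
    define m where "m = max j k"
    have "j \<le> m" "k \<le> m" unfolding m_def by simp_all
    then have "\<langle>c, x\<rangle> \<epsilon> l m" "\<langle>c, x'\<rangle> \<epsilon> r m" "\<langle>d, y\<rangle> \<epsilon> l m" "\<langle>d, y'\<rangle> \<epsilon> r m"
      using cd subsD[OF mono(1)] subsD[OF mono(2)] by blast+
    then show ?thesis by (rule simulates_mem[OF W sim])
  qed
  have total: "\<exists>y. rel x y" for x
  proof -
    obtain k where "task k = Inl x" using task[of 0] by blast
    then obtain c where "\<langle>c, x\<rangle> \<epsilon> l (Suc k)" using F(2)[of k] unfolding performs_def l_def by auto
    then show ?thesis unfolding rel_def using same_dom[of c "Suc k"] by blast
  qed
  have closed: "\<exists>x. rel x z" if y: "rel x y" and z: "z \<epsilon> y \<or> z \<sqsubseteq> y" for x y z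
  proof -
    from y obtain k c where c: "\<langle>c, y\<rangle> \<epsilon> r k" unfolding rel_def by blast
    obtain m where m: "k \<le> m" "task m = Inr (c, z)" using task[of k] by blast
    from c have "\<langle>c, y\<rangle> \<epsilon> r m" by (rule subsD[OF mono(2)[OF m(1)]])
    then obtain d where "\<langle>d, z\<rangle> \<epsilon> r (Suc m)"
      using F(2)[of m] z unfolding performs_def r_def m(2) sum.case prod.case by blast
    then show ?thesis unfolding rel_def using same_dom[of d "Suc m"] by blast
  qed
  \<comment> \<open>Codes do not mention equality. It is preserved since, by extensionality, it is determined by
    membership and since every element of a value on the right is itself such a value.\<close>
  have functional: "y = y'" if "rel x y" "rel x y'" for x y y'
  proof (rule ext)
    have "z \<epsilon> y'" if y: "rel x y" and y': "rel x y'" and z: "z \<epsilon> y" for z y y'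
    proof -
      obtain w where "rel w z" using closed[OF y] z by blast
      then show ?thesis using rel_mem[of w z] y y' z by blast
    qed
    then show "z \<epsilon> y \<longleftrightarrow> z \<epsilon> y'" for z using that by blast
  qed
  have injective: "x = x'" if "rel x y" "rel x' y" for x x' y
  proof (rule ext)
    fix z
    obtain w where "rel z w" using total by blast
    then show "z \<epsilon> x \<longleftrightarrow> z \<epsilon> x'" using rel_mem[of z w] that by blast
  qed
  define i where "i x = (SOME y. rel x y)" for x
  have i: "rel x (i x)" for x unfolding i_def by (rule someI_ex[OF total])
  have range_i: "z \<in> range i" if "rel x z" for x z
    using functional[OF that i[of x]] by simp
  have "self_embedding UNIV E i"
    unfolding self_embedding_def
  proof (intro conjI ballI)
    show "inj_on i UNIV"
      by (rule injI) (metis i injective)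
    show "x \<epsilon> y \<longleftrightarrow> i x \<epsilon> i y" for x y by (rule rel_mem[OF i i])
  qed simp
  moreover have "z \<in> range i" if "z \<epsilon> i x \<or> z \<sqsubseteq> i x" for x z
    using closed[OF i that] range_i by blast
  moreover have "range i \<noteq> UNIV"
  proof -
    have "y \<epsilon> bigunion (bigunion (bigunion (bigunion (bigunion W))))" if "rel x y" for x y
      using that simulates_bounded[OF sim] unfolding rel_def by blast
    then have "i x \<epsilon> bigunion (bigunion (bigunion (bigunion (bigunion W))))" for x using i by blast
    then show ?thesis using not_mem_self by (metis rangeE UNIV_I)
  qed
  moreover have "i x = x" if x: "x \<epsilon> s" for x
  proof (rule functional[OF i])
    have "\<langle>x, x\<rangle> \<epsilon> e\<^sub>0" using x e\<^sub>0(2) by blast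
    then show "rel x x" unfolding rel_def l_def r_def using F(3) by (metis fst_conv snd_conv)
  qed
  ultimately show ?thesis by blast
qed

end

section \<open>Embeddings from separation\<close>

context kpp begin

text \<open>If the rank of \<open>n\<close> is at most that of \<open>i m\<close>, then \<open>n\<close> is a subset of the level at \<open>i m\<close>. This
  level is the image under \<open>i\<close> of the level at \<open>m\<close>, because attempts are defined by a bounded formula.\<close>

lemma rank_initial_if_closed:
  assumes i: "self_embedding UNIV E i"
    and closed: "\<And>x z. z \<epsilon> i x \<or> z \<sqsubseteq> i x \<Longrightarrow> z \<in> range i"
  shows "rank_initial UNIV E i"
proof -
  have "\<not> z \<epsilon> i empty" for z
  proof
    assume z: "z \<epsilon> i empty"
    then obtain w where "z = i w" using closed[of z empty] by blast
    then have "w \<epsilon> empty" using i z unfolding self_embedding_def by blast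
    then show False by simp
  qed
  then have i_empty: "i empty = empty" by (intro ext) simp
  have hier_i: "hier empty (i m) = i (hier empty m)" for m
  proof -
    obtain f where f: "cumul.attempt empty f" "\<langle>m, hier empty m\<rangle> \<epsilon> f"
      using cumul.rec_attempt[of empty m] unfolding hier_def by blast
    have "delta0 (\<lambda>e. cumul.attempt (e 0) (e 1) \<and> \<langle>e 2, e 3\<rangle> \<epsilon> e 1)"
      by (intro delta0_conj cumul.delta0_attempt delta0_kpair_mem)
    from delta0_elementary[OF i closed this, where e = "(!) [empty, f, m, hier empty m]"] f
    have "cumul.attempt empty (i f) \<and> \<langle>i m, i (hier empty m)\<rangle> \<epsilon> i f" by (simp add: i_empty)
    then have "cumul.rec empty (i m) = i (hier empty m)" unfolding cumul.rec_eq_iff by blast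
    then show ?thesis unfolding hier_def .
  qed
  have "n \<in> range i" if "rnk n \<epsilon> rnk (i m) \<or> rnk n = rnk (i m)" for n m
  proof -
    have "hier empty n \<sqsubseteq> hier empty (i m)"
      using that hier_mono[OF transitive_empty, of "rnk n" "rnk (i m)"] hier_rnk[of n] hier_rnk[of "i m"]
      by (auto simp: subs_def)
    then have "n \<sqsubseteq> i (hier empty m)"
      using subs_hier[of n empty] unfolding hier_i by (simp add: subs_def)
    then show ?thesis using closed by blast
  qed
  then show ?thesis unfolding rank_initial_def rank_eq by blast
qed

text \<open>Levels \<open>H k\<close> over \<open>s\<close> along a descending sequence contain all subsets of the next level. The
  iterated singletons of \<open>s\<close> belong to all of them and serve as fresh names; they are distinct and
  outside \<open>s\<close> as \<open>s\<close> is transitive.\<close>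

lemma embeddings_if_separation:
  assumes sep: "separation (SigmaP 1) UNIV E" and "countable (UNIV :: 'a set)" and "\<not> wfp E"
  shows "\<exists>i. self_embedding UNIV E i \<and> range i \<noteq> UNIV \<and> rank_initial UNIV E i \<and>
       (\<forall>m\<in>below_rank UNIV E \<alpha>. i m = m)"
proof -
  obtain y where y: "\<And>k. y (Suc k) \<epsilon> y k"
    using assms(3) unfolding wf_iff_no_infinite_down_chain[to_pred] by blast
  define s where "s = hier empty \<alpha>"
  have s: "transitive s" unfolding s_def by (rule transitive_hier[OF transitive_empty])
  define H where "H k = hier s (y k)" for k
  have H_pow: "D \<epsilon> H k" if "D \<sqsubseteq> H (Suc k)" for D k
    using that mem_hierI[OF y] unfolding H_def by blast
  have H_mono: "H (Suc k) \<sqsubseteq> H k" for k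
    unfolding H_def by (rule hier_mono[OF s y])
  have H_anti: "x \<epsilon> H k" if "k \<le> m" "x \<epsilon> H m" for k m x
    using that by (induction rule: dec_induct) (use H_mono in \<open>auto simp: subs_def\<close>)
  have H_upair: "upair a b \<epsilon> H k" if "a \<epsilon> H (Suc k)" "b \<epsilon> H (Suc k)" for a b k
    using that by (intro H_pow) (auto simp: subs_def)
  have H_pair: "\<langle>a, b\<rangle> \<epsilon> H k" if "a \<epsilon> H (Suc (Suc k))" "b \<epsilon> H (Suc (Suc k))" for a b k
    using that unfolding kpair_def by (intro H_upair)
  define nm where "nm j = ((\<lambda>x. upair x x) ^^ j) s" for j
  have nm_simps: "nm 0 = s" "\<And>j. nm (Suc j) = upair (nm j) (nm j)" unfolding nm_def by simp_all
  have nm_H: "nm j \<epsilon> H k" for j k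
  proof (induction j arbitrary: k)
    case 0
    show ?case unfolding nm_simps by (rule H_pow) (simp add: H_def hier_base)
  next
    case (Suc j)
    then show ?case unfolding nm_simps by (intro H_upair)
  qed
  have nm_new: "\<not> nm j \<epsilon> s" for j
  proof (induction j)
    case 0
    show ?case unfolding nm_simps by simp
  next
    case (Suc j)
    then show ?case using transitiveD[OF s, of "nm (Suc j)" "nm j"] unfolding nm_simps by auto
  qed
  have nm_inj: "nm j = nm k \<Longrightarrow> j = k" for j k
  proof (induction j arbitrary: k)
    case 0
    show ?case
    proof (cases k)
      case (Suc l)
      then have "nm l \<epsilon> s" using 0 nm_simps by (metis mem_upair)
      then show ?thesis using nm_new by blast
    qed simp
  next
    case (Suc j)
    show ?case
    proof (cases k)
      case 0
      then have "nm j \<epsilon> s" using Suc.prems nm_simps by (metis mem_upair)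
      then show ?thesis using nm_new by blast
    next
      case (Suc l)
      then have "nm j = nm l" using Suc.prems nm_simps upair_inject by metis
      then show ?thesis using Suc Suc.IH by blast
    qed
  qed
  \<comment> \<open>Passing from \<open>D \<subseteq> H (n + 5)\<close> to \<open>\<langle>c, \<langle>d, D\<rangle>\<rangle> \<in> H n\<close> takes one level for \<open>D\<close> and two for each
    pair.\<close>
  interpret back_and_forth E s "\<lambda>k. H (5 * k)" nm
  proof (unfold_locales, goal_cases)
    case 1 show ?case by (rule sep)
  next
    case (2 c d D k)
    define n where "n = 5 * k"
    have c: "c \<epsilon> H (Suc (Suc n))"
      by (rule H_anti[OF _ 2(1)]) (simp add: n_def)
    have d: "d \<epsilon> H (Suc (Suc (Suc (Suc n))))"
      by (rule H_anti[OF _ 2(2)]) (simp add: n_def)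
    have "5 * Suc k = Suc (Suc (Suc (Suc (Suc n))))" by (simp add: n_def)
    with 2(3) have "D \<sqsubseteq> H (Suc (Suc (Suc (Suc (Suc n)))))" by (simp only:)
    then have "D \<epsilon> H (Suc (Suc (Suc (Suc n))))" by (rule H_pow)
    with c d show ?case unfolding n_def[symmetric] by (intro H_pair)
  next
    case (3 c k)
    then show ?case unfolding H_def by (rule subsD[OF hier_base])
  next
    case 4 show ?case by (rule nm_H)
  next
    case 5 show ?case by (rule nm_new)
  next
    case 6 show ?case by (rule injI) (rule nm_inj)
  qed
  from embedding_exists[OF assms(2)] obtain i where i: "self_embedding UNIV E i"
    "\<And>x z. z \<epsilon> i x \<or> z \<sqsubseteq> i x \<Longrightarrow> z \<in> range i" "range i \<noteq> UNIV" "\<And>x. x \<epsilon> s \<Longrightarrow> i x = x"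
    by blast
  have "i m = m" if "m \<in> below_rank UNIV E \<alpha>" for m
  proof (rule i(4))
    have "rnk m \<epsilon> \<alpha>" using that unfolding below_rank_def rank_eq by blast
    then show "m \<epsilon> s" unfolding s_def by (rule rnk_mem_hier)
  qed
  moreover have "rank_initial UNIV E i"
    by (rule rank_initial_if_closed[OF i(1)]) (rule i(2))
  ultimately show ?thesis using i(1,3) by blast
qed

lemma separation_iff_embeddings:
  assumes "countable (UNIV :: 'a set)" and "\<not> wfp E"
  shows "separation (SigmaP 1) UNIV E \<longleftrightarrow>
    (\<forall>\<alpha>\<in>Ord_in UNIV E. \<exists>i. self_embedding UNIV E i \<and> range i \<noteq> UNIV \<and> rank_initial UNIV E i \<and>
       (\<forall>m\<in>below_rank UNIV E \<alpha>. i m = m))"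
proof
  assume "separation (SigmaP 1) UNIV E"
  from embeddings_if_separation[OF this assms]
  show "\<forall>\<alpha>\<in>Ord_in UNIV E. \<exists>i. self_embedding UNIV E i \<and> range i \<noteq> UNIV \<and>
      rank_initial UNIV E i \<and> (\<forall>m\<in>below_rank UNIV E \<alpha>. i m = m)" ..
qed (rule separation_if_embeddings, rule bspec)

end

section \<open>Countable models as structures on a type\<close>

text \<open>Countable models are infinite and hence isomorphic to structures on the whole type \<open>nat\<close>. All
  notions of the theorem are invariant under the isomorphism \<open>g\<close>.\<close>

lemma assignments_range: "UNIV \<rightarrow> range g = range (\<lambda>e n. g (e n))"
proof
  show "UNIV \<rightarrow> range g \<subseteq> range (\<lambda>e n. g (e n))"
  proof
    fix e assume "e \<in> UNIV \<rightarrow> range g"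
    then have "\<forall>n. \<exists>x. e n = g x" by blast
    then obtain d where "\<forall>n. e n = g (d n)" by metis
    then show "e \<in> range (\<lambda>e n. g (e n))" by (auto simp: fun_eq_iff)
  qed
qed auto

context
  fixes g :: "'b \<Rightarrow> 'a" and E :: "'a \<Rightarrow> 'a \<Rightarrow> bool" and F :: "'b \<Rightarrow> 'b \<Rightarrow> bool"
  assumes g: "inj g" and F: "\<And>x y. F x y \<longleftrightarrow> E (g x) (g y)"
begin

lemma case_nat_range: "case_nat (g x) (\<lambda>n. g (e n)) = (\<lambda>n. g (case_nat x e n))"
  by (auto simp: fun_eq_iff split: nat.split)

lemma sat_range: "sat (range g) E (\<lambda>n. g (e n)) p \<longleftrightarrow> sat UNIV F e p"
  by (induction p arbitrary: e) (simp_all add: F inj_eq[OF g] case_nat_range)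

lemma separation_range: "separation \<Gamma> (range g) E \<longleftrightarrow> separation \<Gamma> UNIV F"
  unfolding separation_def assignments_range by (simp add: case_nat_range sat_range F)

lemma models_KPP_range: "models_KPP (range g) E \<longleftrightarrow> models_KPP UNIV F"
  unfolding models_KPP_def separation_range extensionality_def pairing_def union_axiom_def
    powerset_def infinity_def collection_def foundation_def assignments_range
  by (simp add: case_nat_range sat_range F[symmetric] inj_eq[OF g])

lemma Ord_in_range: "Ord_in (range g) E = g ` Ord_in UNIV F"
  unfolding Ord_in_def transitive_in_def by (auto simp: F inj_eq[OF g])

lemma maps_to_range: "maps_to (range g) E (g f) (g x) (g y) \<longleftrightarrow> maps_to UNIV F f x y"
  unfolding maps_to_def is_opair_def is_upair_def by (simp add: F inj_eq[OF g])

lemma is_opair_range: "is_opair (range g) E (g f) (g x) (g y) \<longleftrightarrow> is_opair UNIV F f x y"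
  unfolding is_opair_def is_upair_def by (simp add: F inj_eq[OF g])

lemma has_rank_range: "has_rank (range g) E (g x) (g y) \<longleftrightarrow> has_rank UNIV F x y"
proof -
  have ex1: "(\<exists>!y. y \<in> range g \<and> P y) \<longleftrightarrow> (\<exists>!x. P (g x))" for P
    unfolding Ex1_def using injD[OF g] by (auto; blast)
  show ?thesis
    unfolding has_rank_def rank_function_def function_on_def transitive_in_def ex1
    by (simp add: maps_to_range is_opair_range F inj_eq[OF g])
qed

lemma rank_range:
  assumes "kpp F"
  shows "rank (range g) E (g x) = g (rank UNIV F x)"
proof -
  interpret kpp F by (rule assms)
  have "y = g (rnk x)" if "y \<in> range g \<and> has_rank (range g) E (g x) y" for y
    using that has_rank_range has_rank_iff by auto
  moreover have "g (rnk x) \<in> range g \<and> has_rank (range g) E (g x) (g (rnk x))"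
    using has_rank_range has_rank_iff by auto
  ultimately show ?thesis unfolding rank_def[of "range g"] rank_eq by (rule the_equality[rotated])
qed

lemma embedding_range:
  assumes F': "kpp F" and i: "\<And>x. i (g x) = g (j x)"
  shows "(self_embedding (range g) E i \<and> i ` range g \<noteq> range g \<and> rank_initial (range g) E i \<and>
       (\<forall>m\<in>below_rank (range g) E (g \<alpha>). i m = m)) \<longleftrightarrow>
    (self_embedding UNIV F j \<and> range j \<noteq> UNIV \<and> rank_initial UNIV F j \<and>
       (\<forall>m\<in>below_rank UNIV F \<alpha>. j m = m))"
proof -
  have image: "i ` range g = g ` range j" by (simp add: image_image i)
  have "self_embedding (range g) E i \<longleftrightarrow> self_embedding UNIV F j"
    unfolding self_embedding_def by (auto simp: i F inj_on_def inj_eq[OF g] Pi_iff)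
  moreover have "i ` range g \<noteq> range g \<longleftrightarrow> range j \<noteq> UNIV"
    unfolding image using inj_image_eq_iff[OF g] by simp
  moreover have "rank_initial (range g) E i \<longleftrightarrow> rank_initial UNIV F j"
    unfolding rank_initial_def image
    by (simp add: i rank_range[OF F'] F[symmetric] inj_eq[OF g] inj_image_mem_iff[OF g])
  moreover have "below_rank (range g) E (g \<alpha>) = g ` below_rank UNIV F \<alpha>"
    unfolding below_rank_def by (auto simp: rank_range[OF F'] F)
  ultimately show ?thesis by (simp add: i inj_eq[OF g])
qed

lemma ex_embedding_range:
  assumes F': "kpp F"
  shows "(\<exists>i. self_embedding (range g) E i \<and> i ` range g \<noteq> range g \<and> rank_initial (range g) E i \<and>
       (\<forall>m\<in>below_rank (range g) E (g \<alpha>). i m = m)) \<longleftrightarrow>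
    (\<exists>j. self_embedding UNIV F j \<and> range j \<noteq> UNIV \<and> rank_initial UNIV F j \<and>
       (\<forall>m\<in>below_rank UNIV F \<alpha>. j m = m))" (is "(\<exists>i. ?A i) \<longleftrightarrow> (\<exists>j. ?B j)")
proof
  assume "\<exists>i. ?A i"
  then obtain i where i: "?A i" by blast
  then have "\<forall>x. \<exists>y. i (g x) = g y" unfolding self_embedding_def by blast
  then obtain j where "\<And>x. i (g x) = g (j x)" by metis
  then have B: "?B j" by (rule iffD1[OF embedding_range[OF F'] i])
  show "\<exists>j. ?B j" by (rule exI) (rule B)
next
  assume "\<exists>j. ?B j"
  then obtain j where j: "?B j" by blast
  define i where "i x = g (j (inv g x))" for x
  have "i (g x) = g (j x)" for x using g by (simp add: i_def)
  then have A: "?A i" by (rule iffD2[OF embedding_range[OF F'] j])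
  show "\<exists>i. ?A i" by (rule exI) (rule A)
qed

lemma nonstandard_range: "nonstandard (range g) E \<longleftrightarrow> \<not> wfp F"
proof -
  have "wfp_on (range g) E \<longleftrightarrow> wfp F"
  proof
    assume "wfp_on (range g) E"
    then have "wfp_on UNIV F"
      by (rule wfp_on_mono_stronger[where f = g]) (auto simp: F g)
    then show "wfp F" .
  next
    assume "wfp F"
    show "wfp_on (range g) E" unfolding wfp_on_def
    proof (intro allI impI ballI)
      fix P x assume P: "\<forall>x\<in>range g. (\<forall>y\<in>range g. E y x \<longrightarrow> P y) \<longrightarrow> P x" and "x \<in> range g"
      then obtain a where a: "x = g a" by blast
      have "P (g a)" using \<open>wfp F\<close>
        by (induction a rule: wfp_induct_rule) (use P F in blast)
      then show "P x" using a by simp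
    qed
  qed
  then show ?thesis unfolding nonstandard_def by simp
qed

end

text \<open>The singleton map is injective but does not attain the empty set.\<close>

lemma models_KPP_infinite:
  assumes "models_KPP M E"
  shows "infinite M"
proof
  assume fin: "finite M"
  have "\<forall>x\<in>M. \<exists>z\<in>M. \<forall>t\<in>M. E t z \<longleftrightarrow> t = x"
    using assms unfolding models_KPP_def pairing_def by metis
  then obtain sg where sg: "\<And>x. x \<in> M \<Longrightarrow> sg x \<in> M" "\<And>x t. x \<in> M \<Longrightarrow> t \<in> M \<Longrightarrow> E t (sg x) \<longleftrightarrow> t = x"
    by metis
  have "inj_on sg M" by (rule inj_onI) (metis sg)
  then have "sg ` M = M" using endo_inj_surj[OF fin] sg(1) by blast
  moreover obtain z where "z \<in> M" "\<forall>t\<in>M. \<not> E t z"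
    using assms unfolding models_KPP_def infinity_def by blast
  ultimately show False using sg by (metis imageE)
qed

theorem theorem5p3p1:
  fixes M :: "'a set" and E :: "'a \<Rightarrow> 'a \<Rightarrow> bool"
  assumes "models_KPP M E" and "countable M" and "nonstandard M E"
  shows "separation (SigmaP 1) M E \<longleftrightarrow>
    (\<forall>\<alpha>\<in>Ord_in M E. \<exists>i. self_embedding M E i \<and> i ` M \<noteq> M \<and> rank_initial M E i \<and>
       (\<forall>m\<in>below_rank M E \<alpha>. i m = m))"
proof -
  define g where "g = from_nat_into M"
  have "bij_betw g UNIV M"
    unfolding g_def by (rule bij_betw_from_nat_into[OF assms(2) models_KPP_infinite[OF assms(1)]])
  then have g: "inj g" and M: "M = range g" by (auto simp: bij_betw_def)
  define F where "F x y \<longleftrightarrow> E (g x) (g y)" for x y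
  interpret kpp F
    by unfold_locales
      (use assms(1) models_KPP_range[where g = g and E = E and F = F, OF g F_def] M in simp)
  have "\<not> wfp F" using assms(3) nonstandard_range[where g = g and E = E and F = F, OF g F_def] M by simp
  then have "separation (SigmaP 1) UNIV F \<longleftrightarrow>
    (\<forall>\<alpha>\<in>Ord_in UNIV F. \<exists>j. self_embedding UNIV F j \<and> range j \<noteq> UNIV \<and> rank_initial UNIV F j \<and>
       (\<forall>m\<in>below_rank UNIV F \<alpha>. j m = m))"
    by (intro separation_iff_embeddings) simp
  then show ?thesis
    unfolding M separation_range[where g = g and E = E and F = F, OF g F_def]
      Ord_in_range[where g = g and E = E and F = F, OF g F_def] ball_simps(9)
      ex_embedding_range[where g = g and E = E and F = F, OF g F_def kpp_axioms] .
qed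

end
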